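(* If $\Gamma\vdash M:A$ is derivable in $\lambda$A and $M\to_\beta L$ (one-step $\beta$-reduction, anywhere inside $M$), then $\Gamma\vdash L:A$ is also derivable in $\lambda$A.
   Context: Type expressions: fix a countably infinite set of type variables $X,Y,Z,\dots$. Pseudo type expressions are generated by $A::=X\mid A\to A\mid \bullet A\mid \mu X.A$ ($\mu$ binds $X$; $\alpha$-convertible expressions are identified; $\to$ associates to the right; $\bullet$ binds tighter than $\to$, which binds tighter than $\mu$). $A[B/X]$ denotes capture-avoiding substitution. $\top$ abbreviates $\mu X.\bullet X$, and $\bullet^n A$ denotes $A$ prefixed by $n$ copies of $\bullet$. The tail $t(A)$ is defined by $t(X)=X$, $t(A\to B)=t(B)$, $t(\bullet A)=\bullet t(A)$, $t(\mu X.A)=\mu X.t(A)$; it always has the form $\bullet^{m_0}\mu X_1.\bullet^{m_1}\mu X_2.\cdots\mu X_n.\bullet^{m_n}Y$. $A$ is a $\top$-variant iff $Y=X_i$ for some $1\le i\le n$ with $X_i\notin\{X_{i+1},\dots,X_n\}$ and $m_i+\dots+m_n\ge 1$. $A$ is proper in $X$ iff: a variable $Y$ is proper in $X$ iff $Y\neq X$; $\bullet A$ is always proper in $X$; $A\to B$ is proper in $X$ iff both $A,B$ are proper in $X$ or $B$ is a $\top$-variant; for $Y\ne X$, $\mu Y.A$ is proper in $X$ iff $A$ is proper in $X$ or $\mu Y.A$ is a $\top$-variant. Type expressions are the least set of pseudo type expressions containing all type variables, closed under $\to$ and $\bullet$, and containing $\mu X.A$ whenever it contains $A$ and $A$ is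 proper in $X$. Equality: $\cong$ is the least relation on type expressions such that: $A\cong A$; $A\cong B$ implies $B\cong A$; $A\cong B$ and $B\cong C$ imply $A\cong C$; $A\cong B$ implies $\bullet A\cong\bullet B$; $A\cong C$ and $B\cong D$ imply $A\to B\cong C\to D$; $A\to\top\cong\top$; $\mu X.A\cong A[\mu X.A/X]$; and if $A\cong C[A/X]$ with $C$ proper in $X$, then $A\cong\mu X.C$. $\simeq$ is the least relation satisfying the same closure conditions and additionally $\bullet(A\to B)\simeq\bullet A\to\bullet B$. Subtyping: a subtyping assumption $\gamma$ is a finite set of pairs $X\preceq Y$ of type variables in which each type variable occurs at most once; $FTV(\gamma)$ is the set of variables occurring in it. Judgments $\gamma\vdash A\preceq B$ are derived by the rules: $\gamma\cup\{X\preceq Y\}\vdash X\preceq Y$; $\gamma\vdash A\preceq\top$; from $A\simeq B$ infer $\gamma\vdash A\preceq B$; from $\gamma_1\vdash A\preceq B$ and $\gamma_2\vdash B\preceq C$ infer $\gamma_1\cup\gamma_2\vdash A\preceq C$; from $\gamma\vdash A\preceq B$ infer $\gamma\vdash\bullet A\preceq\bullet B$; from $\gamma_1\vdash A'\preceq A$ and $\gamma_2\vdash B\preceq B'$ infer $\gamma_1\cup\gamma_2\vdash A\to B\preceq A'\to B'$; from $\gamma\cup\{X\preceq Y\}\vdash A\preceq B$ infer $\gamma\vdash\mu X.A\preceq\mu Y.B$, provided $X\notin FTV(\gamma)\cup FTV(B)$, $Y\notin FTV(\gamma)\cup FTV(A)$, $A$ is proper in $X$ and $B$ is proper in $Y$;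 and $\gamma\vdash A\preceq\bullet A$. All sets $\gamma\cup\{X\preceq Y\}$, $\gamma_1\cup\gamma_2$ must be well-formed subtyping assumptions. $A\preceq B$ means $\{\}\vdash A\preceq B$ is derivable. Typing system $\lambda$A: untyped $\lambda$-terms $M::=x\mid\lambda x.M\mid MM$ (identified up to $\alpha$-conversion). A typing context $\Gamma$ is a finite map from individual variables to type expressions, written $\{x_1:A_1,\dots,x_n:A_n\}$; $\bullet\Gamma$ is $\{x_1:\bullet A_1,\dots,x_n:\bullet A_n\}$; unions of contexts must be well-formed (a variable receives at most one type). Rules: (var) $\Gamma\cup\{x:A\}\vdash x:A$; (shift) from $\bullet\Gamma\vdash M:\bullet A$ infer $\Gamma\vdash M:A$; ($\top$) $\Gamma\vdash M:\top$; ($\preceq$) from $\Gamma\vdash M:A$ and $A\preceq B$ infer $\Gamma\vdash M:B$; ($\to$I) from $\Gamma\cup\{x:A\}\vdash M:B$ infer $\Gamma\vdash\lambda x.M:A\to B$; ($\to$E) from $\Gamma_1\vdash M:A\to B$ and $\Gamma_2\vdash N:A$ infer $\Gamma_1\cup\Gamma_2\vdash MN:B$. *)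

theory Defs
  imports Main
begin

text \<open>Free type variables are FVar X (names are naturals); mu-bound variables
are de Bruijn indices BVar k. The named binder mu X.A is the function
mu X A = Mu (close X A), so alpha-convertible expressions are identical.\<close>

datatype ty = FVar nat | BVar nat | Arr ty ty | Lat ty | Mu ty

fun tclose :: "nat \<Rightarrow> nat \<Rightarrow> ty \<Rightarrow> ty" where
  "tclose k X (FVar Y) = (if Y = X then BVar k else FVar Y)"
| "tclose k X (BVar n) = BVar n"
| "tclose k X (Arr A B) = Arr (tclose k X A) (tclose k X B)"
| "tclose k X (Lat A) = Lat (tclose k X A)"
| "tclose k X (Mu A) = Mu (tclose (Suc k) X A)"

definition mu :: "nat \<Rightarrow> ty \<Rightarrow> ty" where
  "mu X A = Mu (tclose 0 X A)"

text \<open>Capture-avoiding substitution A[B/X] (B is locally closed).\<close>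
fun tsubst :: "nat \<Rightarrow> ty \<Rightarrow> ty \<Rightarrow> ty" where
  "tsubst X B (FVar Y) = (if Y = X then B else FVar Y)"
| "tsubst X B (BVar n) = BVar n"
| "tsubst X B (Arr A C) = Arr (tsubst X B A) (tsubst X B C)"
| "tsubst X B (Lat A) = Lat (tsubst X B A)"
| "tsubst X B (Mu A) = Mu (tsubst X B A)"

fun ftv :: "ty \<Rightarrow> nat set" where
  "ftv (FVar Y) = {Y}"
| "ftv (BVar n) = {}"
| "ftv (Arr A B) = ftv A \<union> ftv B"
| "ftv (Lat A) = ftv A"
| "ftv (Mu A) = ftv A"

definition top :: ty where
  "top = Mu (Lat (BVar 0))"

definition lats :: "nat \<Rightarrow> ty \<Rightarrow> ty" where
  "lats n A = (Lat ^^ n) A"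

fun tail :: "ty \<Rightarrow> ty" where
  "tail (FVar Y) = FVar Y"
| "tail (BVar n) = BVar n"
| "tail (Arr A B) = tail B"
| "tail (Lat A) = Lat (tail A)"
| "tail (Mu A) = Mu (tail A)"

fun chain :: "(nat \<times> nat) list \<Rightarrow> ty \<Rightarrow> ty" where
  "chain [] B = B"
| "chain ((X, m) # r) B = mu X (lats m (chain r B))"

text \<open>A is a top-variant iff its tail is
  bullet^m0 mu X1. bullet^m1 ... mu Xn. bullet^mn Y with Y = X_i (1 \<le> i \<le> n),
  X_i not among X_{i+1},...,X_n, and m_i + ... + m_n \<ge> 1.
  (Index i below is 0-based.)\<close>
definition top_variant :: "ty \<Rightarrow> bool" where
  "top_variant A \<longleftrightarrow>
     (\<exists>m0 xs Y i. tail A = lats m0 (chain xs (FVar Y)) \<and> i < length xs \<and>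
        fst (xs ! i) = Y \<and> Y \<notin> fst ` set (drop (Suc i) xs) \<and>
        sum_list (map snd (drop i xs)) \<ge> 1)"

text \<open>Properness in X. A bound variable (BVar) is always distinct from the
  free variable X (this is the clause for mu Y.A with Y \<noteq> X after alpha-renaming).\<close>
fun proper :: "nat \<Rightarrow> ty \<Rightarrow> bool" where
  "proper X (FVar Y) = (Y \<noteq> X)"
| "proper X (BVar n) = True"
| "proper X (Lat A) = True"
| "proper X (Arr A B) = ((proper X A \<and> proper X B) \<or> top_variant B)"
| "proper X (Mu A) = (proper X A \<or> top_variant (Mu A))"

inductive tyexp :: "ty \<Rightarrow> bool" where
  te_var: "tyexp (FVar X)"
| te_arr: "tyexp A \<Longrightarrow> tyexp B \<Longrightarrow> tyexp (Arr A B)"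
| te_lat: "tyexp A \<Longrightarrow> tyexp (Lat A)"
| te_mu: "tyexp A \<Longrightarrow> proper X A \<Longrightarrow> tyexp (mu X A)"

inductive tsim :: "ty \<Rightarrow> ty \<Rightarrow> bool" where
  ts_refl: "tyexp A \<Longrightarrow> tsim A A"
| ts_sym: "tsim A B \<Longrightarrow> tsim B A"
| ts_trans: "tsim A B \<Longrightarrow> tsim B C \<Longrightarrow> tsim A C"
| ts_lat: "tsim A B \<Longrightarrow> tsim (Lat A) (Lat B)"
| ts_arr: "tsim A C \<Longrightarrow> tsim B D \<Longrightarrow> tsim (Arr A B) (Arr C D)"
| ts_arrtop: "tyexp A \<Longrightarrow> tsim (Arr A top) top"
| ts_unfold: "tyexp A \<Longrightarrow> proper X A \<Longrightarrow> tsim (mu X A) (tsubst X (mu X A) A)"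
| ts_fix: "tsim A (tsubst X A C) \<Longrightarrow> tyexp C \<Longrightarrow> proper X C \<Longrightarrow> tsim A (mu X C)"
| ts_distr: "tyexp A \<Longrightarrow> tyexp B \<Longrightarrow> tsim (Lat (Arr A B)) (Arr (Lat A) (Lat B))"

text \<open>A subtyping assumption: finite set of pairs (X,Y) meaning X \<preceq> Y, in which each
  type variable occurs at most once.\<close>
definition wf_sa :: "(nat \<times> nat) set \<Rightarrow> bool" where
  "wf_sa g \<longleftrightarrow> finite g \<and> (\<forall>(a, b) \<in> g. a \<noteq> b) \<and>
     (\<forall>p \<in> g. \<forall>q \<in> g. p \<noteq> q \<longrightarrow> {fst p, snd p} \<inter> {fst q, snd q} = {})"

definition FTV_sa :: "(nat \<times> nat) set \<Rightarrow> nat set" where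
  "FTV_sa g = fst ` g \<union> snd ` g"

inductive sub :: "(nat \<times> nat) set \<Rightarrow> ty \<Rightarrow> ty \<Rightarrow> bool" where
  sub_assm: "wf_sa (insert (X, Y) g) \<Longrightarrow> sub (insert (X, Y) g) (FVar X) (FVar Y)"
| sub_top: "wf_sa g \<Longrightarrow> tyexp A \<Longrightarrow> sub g A top"
| sub_sim: "wf_sa g \<Longrightarrow> tsim A B \<Longrightarrow> sub g A B"
| sub_trans: "sub g1 A B \<Longrightarrow> sub g2 B C \<Longrightarrow> wf_sa (g1 \<union> g2) \<Longrightarrow> sub (g1 \<union> g2) A C"
| sub_lat: "sub g A B \<Longrightarrow> sub g (Lat A) (Lat B)"
| sub_arr: "sub g1 A' A \<Longrightarrow> sub g2 B B' \<Longrightarrow> wf_sa (g1 \<union> g2) \<Longrightarrow>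
    sub (g1 \<union> g2) (Arr A B) (Arr A' B')"
| sub_mu: "sub (insert (X, Y) g) A B \<Longrightarrow> wf_sa (insert (X, Y) g) \<Longrightarrow>
    X \<notin> FTV_sa g \<union> ftv B \<Longrightarrow> Y \<notin> FTV_sa g \<union> ftv A \<Longrightarrow>
    proper X A \<Longrightarrow> proper Y B \<Longrightarrow> sub g (mu X A) (mu Y B)"
| sub_later: "wf_sa g \<Longrightarrow> tyexp A \<Longrightarrow> sub g A (Lat A)"

abbreviation subtype :: "ty \<Rightarrow> ty \<Rightarrow> bool" where
  "subtype A B \<equiv> sub {} A B"

datatype trm = Var nat | BV nat | Abs trm | App trm trm

fun lc_at :: "nat \<Rightarrow> trm \<Rightarrow> bool" where
  "lc_at k (Var x) = True"
| "lc_at k (BV i) = (i < k)"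
| "lc_at k (Abs M) = lc_at (Suc k) M"
| "lc_at k (App M N) = (lc_at k M \<and> lc_at k N)"

abbreviation lc :: "trm \<Rightarrow> bool" where "lc M \<equiv> lc_at 0 M"

fun mclose :: "nat \<Rightarrow> nat \<Rightarrow> trm \<Rightarrow> trm" where
  "mclose k x (Var y) = (if y = x then BV k else Var y)"
| "mclose k x (BV i) = BV i"
| "mclose k x (Abs M) = Abs (mclose (Suc k) x M)"
| "mclose k x (App M N) = App (mclose k x M) (mclose k x N)"

definition lam :: "nat \<Rightarrow> trm \<Rightarrow> trm" where
  "lam x M = Abs (mclose 0 x M)"

text \<open>Capture-avoiding substitution M[N/x] (N locally closed).\<close>
fun msubst :: "nat \<Rightarrow> trm \<Rightarrow> trm \<Rightarrow> trm" where
  "msubst x N (Var y) = (if y = x then N else Var y)"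
| "msubst x N (BV i) = BV i"
| "msubst x N (Abs M) = Abs (msubst x N M)"
| "msubst x N (App M1 M2) = App (msubst x N M1) (msubst x N M2)"

inductive beta :: "trm \<Rightarrow> trm \<Rightarrow> bool" where
  b_beta: "lc M \<Longrightarrow> lc N \<Longrightarrow> beta (App (lam x M) N) (msubst x N M)"
| b_app1: "beta M M' \<Longrightarrow> lc N \<Longrightarrow> beta (App M N) (App M' N)"
| b_app2: "beta N N' \<Longrightarrow> lc M \<Longrightarrow> beta (App M N) (App M N')"
| b_abs: "beta M M' \<Longrightarrow> beta (lam x M) (lam x M')"

type_synonym ctx = "nat \<Rightarrow> ty option"

definition wf_ctx :: "ctx \<Rightarrow> bool" where
  "wf_ctx G \<longleftrightarrow> finite (dom G) \<and> (\<forall>A \<in> ran G. tyexp A)"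

definition later_ctx :: "ctx \<Rightarrow> ctx" where
  "later_ctx G = (\<lambda>x. map_option Lat (G x))"

definition compat :: "ctx \<Rightarrow> ctx \<Rightarrow> bool" where
  "compat G1 G2 \<longleftrightarrow> (\<forall>x \<in> dom G1 \<inter> dom G2. G1 x = G2 x)"

inductive typing :: "ctx \<Rightarrow> trm \<Rightarrow> ty \<Rightarrow> bool" where
  t_var: "wf_ctx G \<Longrightarrow> G x = Some A \<Longrightarrow> typing G (Var x) A"
| t_shift: "typing (later_ctx G) M (Lat A) \<Longrightarrow> typing G M A"
| t_top: "wf_ctx G \<Longrightarrow> lc M \<Longrightarrow> typing G M top"
| t_sub: "typing G M A \<Longrightarrow> subtype A B \<Longrightarrow> typing G M B"
| t_abs: "typing (G(x \<mapsto> A)) M B \<Longrightarrow> G x = None \<or> G x = Some A \<Longrightarrow>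
    typing G (lam x M) (Arr A B)"
| t_app: "typing G1 M (Arr A B) \<Longrightarrow> typing G2 N A \<Longrightarrow> compat G1 G2 \<Longrightarrow>
    typing (G1 ++ G2) (App M N) B"

end

theory Submission
  imports Defs
begin

text \<open>
  Generation for abstractions absorbs the shift rule: if \<open>\<Gamma> \<turnstile> \<lambda>x.M : C\<close> and \<open>C\<close> is not a
  \<open>\<top>\<close>-variant, then \<open>\<bullet>\<^sup>k\<Gamma>, x : A \<turnstile> M : B\<close> with \<open>A \<rightarrow> B \<preceq> \<bullet>\<^sup>k C\<close> for some \<open>k\<close>. For a redex one then
  inverts a subtyping \<open>A \<rightarrow> B \<preceq> C \<rightarrow> D\<close>: either \<open>D\<close> is a \<open>\<top>\<close>-variant, hence equal to \<open>\<top>\<close>, or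
  \<open>C \<preceq> \<bullet>\<^sup>n A\<close> and \<open>\<bullet>\<^sup>n B \<preceq> D\<close> for some \<open>n\<close>; the \<open>n\<close> comes from \<open>X \<preceq> \<bullet>X\<close> and the distribution of
  bullets over arrows.

  The inversion goes by induction on derivations and compares heads, i.e. types unfolded until an
  arrow or a variable appears. Its delicate case is the uniqueness rule for \<open>\<mu>X.C\<close> when \<open>C\<close>
  unfolds to \<open>\<bullet>\<^sup>n X\<close>: a type \<open>A\<close> equal to \<open>\<bullet>\<^sup>n A\<close> with \<open>n > 0\<close> has to be a \<open>\<top>\<close>-variant. This
  holds because the variable ending the right spine of a type and the number of bullets in front of
  it are invariant under equality.
\<close>

section \<open>Locally closed types and parallel substitution\<close>

fun lcty :: "nat \<Rightarrow> ty \<Rightarrow> bool" where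
  "lcty k (FVar X) = True"
| "lcty k (BVar i) = (i < k)"
| "lcty k (Arr A B) = (lcty k A \<and> lcty k B)"
| "lcty k (Lat A) = lcty k A"
| "lcty k (Mu A) = lcty (Suc k) A"

fun topen :: "nat \<Rightarrow> ty \<Rightarrow> ty \<Rightarrow> ty" where
  "topen k U (FVar X) = FVar X"
| "topen k U (BVar i) = (if i = k then U else BVar i)"
| "topen k U (Arr A B) = Arr (topen k U A) (topen k U B)"
| "topen k U (Lat A) = Lat (topen k U A)"
| "topen k U (Mu A) = Mu (topen (Suc k) U A)"

text \<open>Parallel form, so that under a binder the update \<open>s(X := FVar X')\<close> renames
  the bound name and substitutes for the other variables in one pass.\<close>

fun psubst :: "(nat \<Rightarrow> ty) \<Rightarrow> ty \<Rightarrow> ty" where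
  "psubst s (FVar X) = s X"
| "psubst s (BVar i) = BVar i"
| "psubst s (Arr A B) = Arr (psubst s A) (psubst s B)"
| "psubst s (Lat A) = Lat (psubst s A)"
| "psubst s (Mu A) = Mu (psubst s A)"

lemma finite_ftv [simp]: "finite (ftv A)"
  by (induction A) auto

lemma fresh_nat:
  assumes "finite S"
  obtains X :: nat where "X \<notin> S"
  using assms ex_new_if_finite infinite_UNIV_nat by blast

lemma tsubst_eq_psubst: "tsubst X U A = psubst (FVar(X := U)) A"
  by (induction A) auto

lemma psubst_cong: "(\<And>X. X \<in> ftv A \<Longrightarrow> s X = t X) \<Longrightarrow> psubst s A = psubst t A"
  by (induction A) auto

lemma psubst_psubst: "psubst s (psubst t A) = psubst (\<lambda>X. psubst s (t X)) A"
  by (induction A) auto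

lemma tsubst_fresh: "X \<notin> ftv A \<Longrightarrow> tsubst X U A = A"
  by (induction A) auto

lemma ftv_psubst: "ftv (psubst s A) = (\<Union>X\<in>ftv A. ftv (s X))"
  by (induction A) auto

lemma ftv_tclose: "ftv (tclose k X A) = ftv A - {X}"
  by (induction A arbitrary: k) auto

lemma ftv_mu: "ftv (mu X A) = ftv A - {X}"
  by (simp add: mu_def ftv_tclose)

lemma tclose_fresh: "X \<notin> ftv A \<Longrightarrow> tclose k X A = A"
  by (induction A arbitrary: k) auto

lemma lcty_tclose: "lcty k A \<Longrightarrow> lcty (Suc k) (tclose k X A)"
  by (induction A arbitrary: k) auto

lemma topen_lcty: "lcty j A \<Longrightarrow> j \<le> k \<Longrightarrow> topen k U A = A"
proof (induction A arbitrary: j k)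
  case (Mu A)
  then show ?case using Mu.IH[of "Suc j" "Suc k"] by simp
qed auto

lemma topen_tclose: "lcty k A \<Longrightarrow> topen k U (tclose k X A) = tsubst X U A"
  by (induction A arbitrary: k) auto

lemma psubst_topen:
  "(\<And>X. lcty 0 (s X)) \<Longrightarrow> psubst s (topen k U A) = topen k (psubst s U) (psubst s A)"
  by (induction A arbitrary: k) (auto simp: topen_lcty[of 0])

lemma psubst_tclose:
  assumes "\<And>Z. Z \<in> ftv A \<Longrightarrow> Z \<noteq> X \<Longrightarrow> X' \<notin> ftv (s Z)"
  shows "psubst s (tclose k X A) = tclose k X' (psubst (s(X := FVar X')) A)"
  using assms by (induction A arbitrary: k) (auto simp: tclose_fresh)

lemma psubst_mu:
  assumes "\<And>Z. Z \<in> ftv A \<Longrightarrow> Z \<noteq> X \<Longrightarrow> X' \<notin> ftv (s Z)"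
  shows "psubst s (mu X A) = mu X' (psubst (s(X := FVar X')) A)"
  using psubst_tclose[OF assms] by (simp add: mu_def)

text \<open>The substitution lemma with a simultaneous change of bound name; it carries the
  unfolding and uniqueness rules through a substitution.\<close>

lemma psubst_tsubst:
  assumes "\<And>Z. Z \<in> ftv A \<Longrightarrow> Z \<noteq> X \<Longrightarrow> X' \<notin> ftv (s Z)"
  shows "psubst s (tsubst X U A) = tsubst X' (psubst s U) (psubst (s(X := FVar X')) A)"
proof -
  have "psubst s U = tsubst X' (psubst s U) (FVar X')"
    by simp
  moreover have "s Z = tsubst X' (psubst s U) (s Z)" if "Z \<in> ftv A" "Z \<noteq> X" for Z
    using that assms by (simp add: tsubst_fresh)
  ultimately show ?thesis
    unfolding tsubst_eq_psubst psubst_psubst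
    by (intro psubst_cong) auto
qed

lemma lcty_tyexp: "tyexp A \<Longrightarrow> lcty 0 A"
  by (induction rule: tyexp.induct) (auto simp: mu_def lcty_tclose)

lemma topen_mu: "tyexp A \<Longrightarrow> topen 0 (mu X A) (tclose 0 X A) = tsubst X (mu X A) A"
  by (simp add: topen_tclose lcty_tyexp)


section \<open>The end of the right spine\<close>

text \<open>\<open>SFree n X\<close> and \<open>SBound n i\<close> record the variable at which the tail of a type ends together
  with the number of bullets above it; \<open>SBad\<close> is the outcome for non-contractive tails such as
  \<open>\<mu>X. X\<close>.\<close>

datatype spine = STop | SBad | SFree nat nat | SBound nat nat

fun slats :: "nat \<Rightarrow> spine \<Rightarrow> spine" where
  "slats k STop = STop"
| "slats k SBad = SBad"
| "slats k (SFree n X) = SFree (k + n) X"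
| "slats k (SBound n i) = SBound (k + n) i"

text \<open>Index 0 is the variable bound here: with no bullet above it the recursion is
  non-contractive, with at least one it is a \<open>\<top>\<close>-variant. Any other index drops by
  one on leaving the binder.\<close>

fun smu :: "spine \<Rightarrow> spine" where
  "smu (SBound n i) = (case i of 0 \<Rightarrow> (if n = 0 then SBad else STop) | Suc j \<Rightarrow> SBound n j)"
| "smu s = s"

fun spine_of :: "ty \<Rightarrow> spine" where
  "spine_of (FVar X) = SFree 0 X"
| "spine_of (BVar i) = SBound 0 i"
| "spine_of (Arr A B) = spine_of B"
| "spine_of (Lat A) = slats 1 (spine_of A)"
| "spine_of (Mu A) = smu (spine_of A)"

lemma slats_slats [simp]: "slats k (slats l s) = slats (k + l) s"
  by (cases s) auto

lemma slats_0 [simp]: "slats 0 s = s"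
  by (cases s) auto

lemma slats_eq_STop [simp]: "slats k s = STop \<longleftrightarrow> s = STop"
  by (cases s) auto

lemma lats_0 [simp]: "lats 0 A = A"
  by (simp add: lats_def)

lemma lats_Suc [simp]: "lats (Suc k) A = Lat (lats k A)"
  by (simp add: lats_def)

lemma lats_Lat: "lats k (Lat A) = Lat (lats k A)"
  by (induction k) auto

lemma lats_lats: "lats k (lats l A) = lats (k + l) A"
  by (induction k) auto

lemma ftv_lats [simp]: "ftv (lats k A) = ftv A"
  by (induction k) auto

lemma spine_lats [simp]: "spine_of (lats k A) = slats k (spine_of A)"
  by (induction k) auto

lemma spine_tail: "spine_of (tail A) = spine_of A"
  by (induction A) auto

lemma spine_tclose:
  "spine_of (tclose k X A) =
     (case spine_of A of SFree n Y \<Rightarrow> if Y = X then SBound n k else SFree n Y | s \<Rightarrow> s)"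
  by (induction A arbitrary: k) (auto split: spine.splits nat.splits)

lemma spine_mu_SFree:
  "spine_of A = SFree n Y \<Longrightarrow>
     spine_of (mu X A) = (if Y = X then if n = 0 then SBad else STop else SFree n Y)"
  by (simp add: mu_def spine_tclose)

lemma spine_mu_STop: "spine_of A = STop \<Longrightarrow> spine_of (mu X A) = STop"
  by (simp add: mu_def spine_tclose)

lemma spine_lcty: "lcty k A \<Longrightarrow> spine_of A = SBound n i \<Longrightarrow> i < k"
proof (induction A arbitrary: k n i)
  case (Lat A)
  then show ?case by (cases "spine_of A") auto
next
  case (Mu A)
  then show ?case by (cases "spine_of A") (fastforce split: nat.splits if_splits)+
qed auto

lemma spine_psubst:
  assumes "\<And>X. lcty 0 (s X)"
  shows "spine_of (psubst s A) =
    (case spine_of A of SFree n X \<Rightarrow> slats n (spine_of (s X)) | r \<Rightarrow> r)"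
proof (induction A)
  case (Lat A)
  then show ?case by (simp split: spine.splits)
next
  case (Mu A)
  \<comment> \<open>A locally closed image never ends at an index, so an enclosing binder leaves its
    spine alone.\<close>
  have "smu (slats n (spine_of (s X))) = slats n (spine_of (s X))" for n X
    using assms[of X] spine_lcty[of 0 "s X"] by (cases "spine_of (s X)") auto
  with Mu show ?case by (auto split: spine.splits nat.splits)
qed auto

section \<open>Agreement of spines with the chain definition of
  \<open>\<top>\<close>-variants\<close>

lemma spine_chain_fresh:
  "Y \<notin> fst ` set xs \<Longrightarrow> spine_of (chain xs (FVar Y)) = SFree (sum_list (map snd xs)) Y"
  by (induction xs) (auto simp: spine_mu_SFree)

lemma spine_chain_STop:
  "spine_of (chain ys B) = STop \<Longrightarrow> spine_of (chain (xs @ ys) B) = STop"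
  by (induction xs) (auto simp: spine_mu_STop)

lemma ftv_chain: "ftv (chain xs B) = ftv B - fst ` set xs"
  by (induction xs) (auto simp: ftv_mu)

fun arrow_free :: "ty \<Rightarrow> bool" where
  "arrow_free (FVar X) = True"
| "arrow_free (BVar i) = True"
| "arrow_free (Arr A B) = False"
| "arrow_free (Lat A) = arrow_free A"
| "arrow_free (Mu A) = arrow_free A"

lemma arrow_free_tail: "arrow_free (tail A)"
  by (induction A) auto

text \<open>An arrow-free type is a string of bullets and binders over one variable, so it can be
  read back as a named chain. The dangling index gets the name 0 and every binder the name 1, which
  captures nothing.\<close>

lemma chain_of_SBound:
  assumes "arrow_free A" "spine_of A = SBound n k"
  shows "\<exists>m xs. A = tclose k 0 (lats m (chain xs (FVar 0))) \<and> 0 \<notin> fst ` set xs \<and>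
    m + sum_list (map snd xs) = n"
  using assms
proof (induction A arbitrary: n k)
  case (BVar i)
  then have "BVar i = tclose k 0 (lats 0 (chain [] (FVar 0)))" "n = 0" by auto
  then show ?case by (metis add_0 empty_iff empty_set image_empty list.simps(8) sum_list.Nil)
next
  case (Lat A)
  then obtain n' where n': "n = Suc n'" "spine_of A = SBound n' k"
    by (cases "spine_of A") auto
  with Lat obtain m xs where "A = tclose k 0 (lats m (chain xs (FVar 0)))" "0 \<notin> fst ` set xs"
    "m + sum_list (map snd xs) = n'" by fastforce
  then have "Lat A = tclose k 0 (lats (Suc m) (chain xs (FVar 0)))" "0 \<notin> fst ` set xs"
    "Suc m + sum_list (map snd xs) = n"
    using n' by auto
  then show ?case by blast
next
  case (Mu A)
  then have "spine_of A = SBound n (Suc k)"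
    by (cases "spine_of A") (auto split: nat.splits if_splits)
  with Mu obtain m xs where *: "A = tclose (Suc k) 0 (lats m (chain xs (FVar 0)))"
    "0 \<notin> fst ` set xs" "m + sum_list (map snd xs) = n" by fastforce
  have "tclose 0 1 (lats m (chain xs (FVar 0))) = lats m (chain xs (FVar 0))"
    by (intro tclose_fresh) (simp add: ftv_chain)
  with * have "Mu A = tclose k 0 (lats 0 (chain ((1, m) # xs) (FVar 0)))"
    "0 \<notin> fst ` set ((1, m) # xs)" "0 + sum_list (map snd ((1, m) # xs)) = n"
    by (auto simp: mu_def)
  then show ?case by blast
qed auto

text \<open>The binder that catches the end of the spine is named 0, those outside it 1. It is the
  entry at index \<open>i\<close>, so \<open>i\<close> grows by one under each outer binder.\<close>

lemma chain_of_STop: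
  assumes "arrow_free A" "spine_of A = STop"
  shows "\<exists>m xs i. A = lats m (chain xs (FVar 0)) \<and> i < length xs \<and>
        fst (xs ! i) = 0 \<and> 0 \<notin> fst ` set (drop (Suc i) xs) \<and>
        sum_list (map snd (drop i xs)) \<ge> 1"
  using assms
proof (induction A)
  case (Lat A)
  then obtain m xs i where *: "A = lats m (chain xs (FVar 0))" "i < length xs"
        "fst (xs ! i) = 0" "0 \<notin> fst ` set (drop (Suc i) xs)"
        "sum_list (map snd (drop i xs)) \<ge> 1"
    by auto
  then have "Lat A = lats (Suc m) (chain xs (FVar 0))" by simp
  with * show ?case by blast
next
  case (Mu A)
  consider "spine_of A = STop" | n where "spine_of A = SBound n 0" "n \<noteq> 0"
    using Mu.prems by (cases "spine_of A") (auto split: nat.splits if_splits)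
  then show ?case
  proof cases
    case 1
    with Mu obtain m xs i where *: "A = lats m (chain xs (FVar 0))" "i < length xs"
        "fst (xs ! i) = 0" "0 \<notin> fst ` set (drop (Suc i) xs)"
        "sum_list (map snd (drop i xs)) \<ge> 1"
      by auto
    have "tclose 0 1 A = A"
      by (intro tclose_fresh) (simp add: ftv_chain *)
    with * have "Mu A = lats 0 (chain ((1, m) # xs) (FVar 0))"
      by (simp add: mu_def)
    moreover have "Suc i < length ((1, m) # xs)" "fst (((1, m) # xs) ! Suc i) = 0"
      "0 \<notin> fst ` set (drop (Suc (Suc i)) ((1, m) # xs))"
      "sum_list (map snd (drop (Suc i) ((1, m) # xs))) \<ge> 1"
      using * by auto
    ultimately show ?thesis by blast
  next
    case 2
    with Mu.prems chain_of_SBound[of A n 0] obtain m xs where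
      *: "A = tclose 0 0 (lats m (chain xs (FVar 0)))" "0 \<notin> fst ` set xs"
      "m + sum_list (map snd xs) = n" by auto
    have "Mu A = lats 0 (chain ((0, m) # xs) (FVar 0))" "0 < length ((0, m) # xs)"
      "fst (((0, m) # xs) ! 0) = 0" "0 \<notin> fst ` set (drop (Suc 0) ((0, m) # xs))"
      "sum_list (map snd (drop 0 ((0, m) # xs))) \<ge> 1"
      using * 2 by (auto simp: mu_def)
    then show ?thesis by blast
  qed
qed auto

text \<open>Replaces the existential over chains by a recursive computation, in which all later
  arguments about \<open>\<top>\<close>-variants are carried out.\<close>

lemma top_variant_iff: "top_variant A \<longleftrightarrow> spine_of A = STop"
proof
  assume "top_variant A"
  then obtain m xs Y i where A: "tail A = lats m (chain xs (FVar Y))" and i: "i < length xs"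
    and *: "fst (xs ! i) = Y" "Y \<notin> fst ` set (drop (Suc i) xs)"
    "sum_list (map snd (drop i xs)) \<ge> 1"
    unfolding top_variant_def by blast
  define p where "p = snd (xs ! i)"
  have xs: "drop i xs = (Y, p) # drop (Suc i) xs"
    using i * by (metis Cons_nth_drop_Suc p_def prod.collapse)
  define n where "n = p + sum_list (map snd (drop (Suc i) xs))"
  have "1 \<le> n" using *(3) unfolding xs n_def by simp
  then have "n \<noteq> 0" by simp
  moreover have "spine_of (lats p (chain (drop (Suc i) xs) (FVar Y))) = SFree n Y"
    using * by (simp add: spine_chain_fresh n_def)
  ultimately have "spine_of (chain (drop i xs) (FVar Y)) = STop"
    unfolding xs chain.simps by (subst spine_mu_SFree) auto
  then have "spine_of (chain xs (FVar Y)) = STop"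
    using spine_chain_STop[of "drop i xs" _ "take i xs"] by simp
  then show "spine_of A = STop"
    using A spine_tail[of A] by simp
next
  assume "spine_of A = STop"
  then show "top_variant A"
    using chain_of_STop[OF arrow_free_tail[of A]] unfolding top_variant_def spine_tail by blast
qed

text \<open>The contractivity content of properness: a binder for \<open>X\<close> that catches the
  end of the spine yields \<open>STop\<close>, never \<open>SBad\<close>.\<close>

lemma proper_spine: "proper X A \<Longrightarrow> spine_of A = SFree n X \<Longrightarrow> n \<noteq> 0"
proof (induction A arbitrary: n)
  case (Lat A)
  then show ?case by (cases "spine_of A") auto
next
  case (Mu A)
  then show ?case by (cases "spine_of A") (auto simp: top_variant_iff split: nat.splits if_splits)
qed (auto simp: top_variant_iff)

lemma spine_tyexp: "tyexp A \<Longrightarrow> spine_of A = STop \<or> (\<exists>n X. spine_of A = SFree n X)"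
proof (induction rule: tyexp.induct)
  case (te_mu A X)
  then show ?case
    using proper_spine[OF te_mu.hyps(2)] by (fastforce simp: spine_mu_STop spine_mu_SFree)
qed auto

lemma tyexp_SFreeE:
  assumes "tyexp A" "spine_of A \<noteq> STop"
  obtains n X where "spine_of A = SFree n X"
  using spine_tyexp assms by blast


section \<open>Closure under substitution\<close>

lemma proper_fresh: "X \<notin> ftv A \<Longrightarrow> proper X A"
  by (induction A) auto

lemma spine_psubst_STop:
  "(\<And>X. lcty 0 (s X)) \<Longrightarrow> spine_of A = STop \<Longrightarrow> spine_of (psubst s A) = STop"
  by (simp add: spine_psubst)

text \<open>The alternatives of properness that ask for a \<open>\<top>\<close>-variant survive
  because an \<open>STop\<close> spine is stable under substitution; elsewhere \<open>X'\<close> can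
  enter only through \<open>X\<close>.\<close>

lemma proper_psubst:
  assumes "proper X A" and lc: "\<And>Z. lcty 0 (s Z)"
    and "\<And>Z. Z \<in> ftv A \<Longrightarrow> Z \<noteq> X \<Longrightarrow> X' \<notin> ftv (s Z)"
  shows "proper X' (psubst s A)"
  using assms(1,3)
proof (induction A)
  case (Arr A B)
  have "spine_of B = STop \<Longrightarrow> spine_of (psubst s B) = STop"
    using lc by (rule spine_psubst_STop)
  then show ?case using Arr by (auto simp: top_variant_iff)
next
  case (Mu A)
  have "spine_of (Mu A) = STop \<Longrightarrow> spine_of (psubst s (Mu A)) = STop"
    using lc by (rule spine_psubst_STop)
  then show ?case using Mu by (auto simp: top_variant_iff)
qed (auto simp: proper_fresh)

lemma psubst_mu_fresh:
  assumes "proper X A" "\<And>Z. lcty 0 (s Z)"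
  obtains X' where "X' \<notin> (\<Union>Z\<in>ftv A. ftv (s Z))"
    "psubst s (mu X A) = mu X' (psubst (s(X := FVar X')) A)"
    "proper X' (psubst (s(X := FVar X')) A)"
proof -
  have "finite (\<Union>Z\<in>ftv A. ftv (s Z))" by simp
  then obtain X' where X': "X' \<notin> (\<Union>Z\<in>ftv A. ftv (s Z))"
    by (rule fresh_nat)
  show thesis
  proof (rule that)
    show "psubst s (mu X A) = mu X' (psubst (s(X := FVar X')) A)"
      using X' by (intro psubst_mu) auto
    show "proper X' (psubst (s(X := FVar X')) A)"
      using X' assms by (intro proper_psubst[of X]) auto
  qed (use X' in auto)
qed

lemma tyexp_psubst: "tyexp A \<Longrightarrow> (\<And>X. tyexp (s X)) \<Longrightarrow> tyexp (psubst s A)"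
proof (induction arbitrary: s rule: tyexp.induct)
  case (te_mu A X)
  have lc: "lcty 0 (s Z)" for Z
    using te_mu.prems by (rule lcty_tyexp)
  obtain X' where "X' \<notin> (\<Union>Z\<in>ftv A. ftv (s Z))"
    "psubst s (mu X A) = mu X' (psubst (s(X := FVar X')) A)"
    "proper X' (psubst (s(X := FVar X')) A)"
    by (rule psubst_mu_fresh[where s = s, OF te_mu.hyps(2) lc])
  moreover have "tyexp (psubst (s(X := FVar X')) A)"
    using te_mu.prems by (intro te_mu.IH) (simp add: te_var)
  ultimately show ?case
    by (simp add: tyexp.te_mu)
qed (simp_all add: te_arr te_lat)

lemma tyexp_tsubst: "tyexp A \<Longrightarrow> tyexp U \<Longrightarrow> tyexp (tsubst X U A)"
  unfolding tsubst_eq_psubst by (rule tyexp_psubst) (auto intro: te_var)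

lemma top_eq_mu: "top = mu X (Lat (FVar X))"
  by (simp add: top_def mu_def)

lemma tyexp_top: "tyexp top"
  unfolding top_eq_mu[of 0] by (intro tyexp.intros) auto

lemma spine_top [simp]: "spine_of top = STop"
  by (simp add: top_def)

lemma ftv_top [simp]: "ftv top = {}"
  by (simp add: top_def)

lemma psubst_top [simp]: "psubst s top = top"
  by (simp add: top_def)

lemma tyexp_LatD: "tyexp (Lat A) \<Longrightarrow> tyexp A"
  by (erule tyexp.cases) (auto simp: mu_def)

lemma tyexp_ArrD: "tyexp (Arr A B) \<Longrightarrow> tyexp A \<and> tyexp B"
  by (erule tyexp.cases) (auto simp: mu_def)

text \<open>Restores a named binder, so that the opening performed by \<open>head_of\<close> becomes
  the unfolding used by \<open>tsim\<close>.\<close>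

lemma tyexp_MuE:
  assumes "tyexp (Mu A)"
  obtains X B where "Mu A = mu X B" "tyexp B" "proper X B" "topen 0 (Mu A) A = tsubst X (Mu A) B"
  using assms by (cases rule: tyexp.cases) (auto simp: mu_def topen_tclose lcty_tyexp)

lemma tyexp_lats: "tyexp A \<Longrightarrow> tyexp (lats k A)"
  by (induction k) (auto intro: te_lat)

section \<open>Equality under substitution and recursion\<close>

lemma tsim_tyexp: "tsim A B \<Longrightarrow> tyexp A \<and> tyexp B"
  by (induction rule: tsim.induct)
    (auto intro: tyexp.intros tyexp_top tyexp_tsubst)

lemma tsim_psubst: "tsim A B \<Longrightarrow> (\<And>X. tyexp (s X)) \<Longrightarrow> tsim (psubst s A) (psubst s B)"
proof (induction arbitrary: s rule: tsim.induct)
  case (ts_unfold A X)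
  have lc: "lcty 0 (s Z)" for Z
    using ts_unfold.prems by (rule lcty_tyexp)
  obtain X' where X': "X' \<notin> (\<Union>Z\<in>ftv A. ftv (s Z))"
    "psubst s (mu X A) = mu X' (psubst (s(X := FVar X')) A)"
    "proper X' (psubst (s(X := FVar X')) A)"
    by (rule psubst_mu_fresh[where s = s, OF ts_unfold.hyps(2) lc])
  have "tyexp (psubst (s(X := FVar X')) A)"
    using ts_unfold.hyps ts_unfold.prems by (intro tyexp_psubst) (simp_all add: te_var)
  moreover have "psubst s (tsubst X (mu X A) A)
      = tsubst X' (psubst s (mu X A)) (psubst (s(X := FVar X')) A)"
    using X'(1) by (intro psubst_tsubst) auto
  ultimately show ?case
    using X' tsim.ts_unfold by simp
next
  case (ts_fix A X C)
  have lc: "lcty 0 (s Z)" for Z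
    using ts_fix.prems by (rule lcty_tyexp)
  obtain X' where X': "X' \<notin> (\<Union>Z\<in>ftv C. ftv (s Z))"
    "psubst s (mu X C) = mu X' (psubst (s(X := FVar X')) C)"
    "proper X' (psubst (s(X := FVar X')) C)"
    by (rule psubst_mu_fresh[where s = s, OF ts_fix.hyps(3) lc])
  have "tyexp (psubst (s(X := FVar X')) C)"
    using ts_fix.hyps ts_fix.prems by (intro tyexp_psubst) (simp_all add: te_var)
  moreover have "psubst s (tsubst X A C) = tsubst X' (psubst s A) (psubst (s(X := FVar X')) C)"
    using X'(1) by (intro psubst_tsubst) auto
  ultimately show ?case
    using X' ts_fix.IH[of s] ts_fix.prems by (simp add: tsim.ts_fix)
next
  case (ts_sym A B)
  then show ?case by (blast intro: tsim.ts_sym)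
next
  case (ts_trans A B C)
  then show ?case by (blast intro: tsim.ts_trans)
qed (auto intro: ts_refl ts_lat ts_arr ts_arrtop ts_distr tyexp_psubst)

lemma tsim_tsubst: "tsim A B \<Longrightarrow> tyexp U \<Longrightarrow> tsim (tsubst X U A) (tsubst X U B)"
  unfolding tsubst_eq_psubst by (rule tsim_psubst) (auto intro: te_var)

text \<open>Congruence under a recursion is not among the rules. Unfold \<open>mu X A\<close>,
  rewrite its body by the substituted equality, and fold again by uniqueness.\<close>

lemma tsim_mu:
  assumes "tsim A B" "proper X A" "proper X B"
  shows "tsim (mu X A) (mu X B)"
proof -
  have "tyexp A" "tyexp B" using tsim_tyexp assms by auto
  then have "tsim (mu X A) (tsubst X (mu X A) A)"
    using assms by (intro ts_unfold)
  moreover have "tsim (tsubst X (mu X A) A) (tsubst X (mu X A) B)"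
    using assms \<open>tyexp A\<close> by (intro tsim_tsubst te_mu)
  ultimately have "tsim (mu X A) (tsubst X (mu X A) B)"
    by (rule ts_trans)
  then show ?thesis
    using assms \<open>tyexp B\<close> by (intro ts_fix)
qed

lemma tsim_psubst_cong:
  "tyexp A \<Longrightarrow> (\<And>X. tsim (s X) (t X)) \<Longrightarrow> tsim (psubst s A) (psubst t A)"
proof (induction arbitrary: s t rule: tyexp.induct)
  case (te_mu A X)
  have lc: "lcty 0 (s Z)" "lcty 0 (t Z)" for Z
    using te_mu.prems[of Z] tsim_tyexp lcty_tyexp by blast+
  \<comment> \<open>One bound name has to serve both substitutions.\<close>
  have "finite ((\<Union>Z\<in>ftv A. ftv (s Z)) \<union> (\<Union>Z\<in>ftv A. ftv (t Z)))" by simp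
  then obtain X' where X': "X' \<notin> (\<Union>Z\<in>ftv A. ftv (s Z)) \<union> (\<Union>Z\<in>ftv A. ftv (t Z))"
    by (rule fresh_nat)
  have "psubst s (mu X A) = mu X' (psubst (s(X := FVar X')) A)"
    "psubst t (mu X A) = mu X' (psubst (t(X := FVar X')) A)"
    using X' by (auto intro: psubst_mu)
  moreover have "proper X' (psubst (s(X := FVar X')) A)" "proper X' (psubst (t(X := FVar X')) A)"
    using X' te_mu.hyps lc by (auto intro!: proper_psubst[of X])
  moreover have "tsim (psubst (s(X := FVar X')) A) (psubst (t(X := FVar X')) A)"
    using te_mu.prems by (intro te_mu.IH) (simp add: ts_refl te_var)
  ultimately show ?case
    by (simp add: tsim_mu)
qed (auto intro: ts_refl ts_lat ts_arr)

lemma tsim_tsubst_cong: "tyexp A \<Longrightarrow> tsim U V \<Longrightarrow> tsim (tsubst X U A) (tsubst X V A)"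
  unfolding tsubst_eq_psubst by (rule tsim_psubst_cong) (auto intro: ts_refl te_var)

lemma tsim_Lat_top: "tsim (Lat top) top"
  using ts_unfold[of "Lat (FVar 0)" 0] top_eq_mu[of 0]
  by (simp add: te_lat te_var ts_sym)

text \<open>The second conjunct strengthens the induction: when a binder catches the end
  \<open>Y\<close> of its body, the uniqueness rule asks that the body with \<open>top\<close> for
  \<open>Y\<close> equal \<open>top\<close>.\<close>

lemma tsim_top_aux:
  "tyexp A \<Longrightarrow> (spine_of A = STop \<longrightarrow> tsim A top) \<and>
     (\<forall>n X. spine_of A = SFree n X \<longrightarrow> tsim (tsubst X top A) top)"
proof (induction rule: tyexp.induct)
  case (te_var X)
  then show ?case by (auto intro: ts_refl tyexp_top)
next
  case (te_arr A B)
  have "tsim (Arr C D) top" if "tyexp C" "tsim D top" for C D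
    using that by (blast intro: ts_trans[OF ts_arr ts_arrtop] ts_refl)
  then show ?case
    using te_arr tyexp_tsubst tyexp_top by simp
next
  case (te_lat A)
  have "tsim (Lat C) top" if "tsim C top" for C
    using that by (rule ts_trans[OF ts_lat tsim_Lat_top])
  then show ?case
    using te_lat by (cases "spine_of A") simp_all
next
  case (te_mu A Y)
  \<comment> \<open>\<open>top\<close> solves the equation that defines \<open>mu Y C\<close>, so
    uniqueness identifies the two.\<close>
  have fix_top: "tsim (mu Y C) top" if "tyexp C" "proper Y C" "tsim (tsubst Y top C) top" for C
    using ts_sym[OF that(3)] that(1,2) by (intro ts_sym[OF ts_fix])
  show ?case
  proof (intro conjI impI allI)
    assume "spine_of (mu Y A) = STop"
    then consider "spine_of A = STop" | n where "spine_of A = SFree n Y"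
      using te_mu.hyps(1) spine_tyexp[of A] by (fastforce simp: spine_mu_SFree split: if_splits)
    then have "tsim (tsubst Y top A) top"
    proof cases
      case 1
      then show ?thesis
        using te_mu.IH tsim_tsubst[of A top top Y] tyexp_top by (simp add: tsubst_fresh)
    next
      case 2
      then show ?thesis using te_mu.IH by blast
    qed
    then show "tsim (mu Y A) top" using fix_top te_mu.hyps by blast
  next
    fix n X assume *: "spine_of (mu Y A) = SFree n X"
    then have "spine_of A = SFree n X" and "X \<noteq> Y"
      using te_mu.hyps(1) spine_tyexp[of A]
      by (auto simp: spine_mu_SFree spine_mu_STop split: if_splits)
    then have top: "tsim (tsubst X top A) top"
      using te_mu.IH by blast
    have "proper Y (tsubst X top A)"
      unfolding tsubst_eq_psubst using te_mu.hyps tyexp_top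
      by (intro proper_psubst[of Y]) (auto simp: lcty_tyexp)
    moreover have "tsubst X top (mu Y A) = mu Y (tsubst X top A)"
      unfolding tsubst_eq_psubst using \<open>X \<noteq> Y\<close>
      by (subst psubst_mu[of _ _ Y]) (auto simp: fun_upd_idem)
    \<comment> \<open>Substitute for \<open>Y\<close> on both sides of the equality
      \<open>top\<close>; the closed type on its right is unaffected.\<close>
    moreover have "tsim (tsubst Y top (tsubst X top A)) top"
      using tsim_tsubst[OF top tyexp_top, of Y] by (simp add: tsubst_fresh)
    ultimately show "tsim (tsubst X top (mu Y A)) top"
      using fix_top te_mu.hyps tyexp_tsubst tyexp_top by simp
  qed
qed

lemma tsim_top: "tyexp A \<Longrightarrow> spine_of A = STop \<Longrightarrow> tsim A top"
  using tsim_top_aux by blast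


section \<open>Inversion of equality\<close>

datatype head = HVar nat | HArr ty ty

text \<open>Bullets before a variable are dropped: \<open>spine_of\<close> records them, and heads
  serve only to compare the components of arrows.\<close>

fun hlat :: "head \<Rightarrow> head" where
  "hlat (HVar X) = HVar X"
| "hlat (HArr A B) = HArr (Lat A) (Lat B)"

fun hsubst :: "(nat \<Rightarrow> ty) \<Rightarrow> head \<Rightarrow> head" where
  "hsubst s (HVar X) = HVar X"
| "hsubst s (HArr A B) = HArr (psubst s A) (psubst s B)"

text \<open>The head of a type after unfolding its leading recursions, with the bullets in front of an
  arrow distributed over it.\<close>

inductive head_of :: "ty \<Rightarrow> head \<Rightarrow> bool" where
  ho_var: "head_of (FVar X) (HVar X)"
| ho_arr: "head_of (Arr A B) (HArr A B)"
| ho_lat: "head_of A H \<Longrightarrow> head_of (Lat A) (hlat H)"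
| ho_mu: "head_of (topen 0 (Mu A) A) H \<Longrightarrow> head_of (Mu A) H"

inductive_cases head_of_ArrE: "head_of (Arr A B) H"
inductive_cases head_of_LatE: "head_of (Lat A) H"
inductive_cases head_of_MuE: "head_of (Mu A) H"
inductive_cases head_of_FVarE: "head_of (FVar X) H"

lemma head_of_unique: "head_of A H \<Longrightarrow> head_of A K \<Longrightarrow> H = K"
proof (induction arbitrary: K rule: head_of.induct)
  case (ho_var X)
  then show ?case by (rule head_of_FVarE) simp
next
  case (ho_arr A B)
  then show ?case by (rule head_of_ArrE) simp
next
  case (ho_lat A H)
  from ho_lat.prems show ?case by (rule head_of_LatE) (simp add: ho_lat.IH)
next
  case (ho_mu A H)
  from ho_mu.prems show ?case by (rule head_of_MuE) (simp add: ho_mu.IH)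
qed

lemma head_of_mu: "tyexp A \<Longrightarrow> head_of (mu X A) H \<longleftrightarrow> head_of (tsubst X (mu X A) A) H"
  using topen_mu[of A X] ho_mu[of "tclose 0 X A" H] head_of_MuE[of "tclose 0 X A" H]
  unfolding mu_def by metis

text \<open>A substitution keeps the head unless it replaces the head variable, which the last
  hypothesis excludes; this is why \<open>hsubst\<close> leaves \<open>HVar\<close> alone.\<close>

lemma head_of_psubst:
  assumes "head_of A H" "\<And>X. lcty 0 (s X)" "\<And>X. H = HVar X \<Longrightarrow> s X = FVar X"
  shows "head_of (psubst s A) (hsubst s H)"
  using assms(1,3)
proof (induction rule: head_of.induct)
  case (ho_lat A H)
  then have "head_of (psubst s A) (hsubst s H)" by (cases H) auto
  moreover have "hsubst s (hlat H) = hlat (hsubst s H)" by (cases H) auto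
  ultimately show ?case by (simp add: head_of.ho_lat)
next
  case (ho_mu A H)
  then show ?case using psubst_topen[OF assms(2)] by (auto intro: head_of.ho_mu)
qed (auto intro: head_of.intros)

lemma head_of_tsubst:
  assumes "head_of A H" "tyexp U" "H \<noteq> HVar X"
  shows "head_of (tsubst X U A) (hsubst (FVar(X := U)) H)"
  unfolding tsubst_eq_psubst using assms
  by (intro head_of_psubst) (auto simp: lcty_tyexp)

lemma head_of_mu_subst:
  assumes "head_of A H" "tyexp A" "proper X A" "H \<noteq> HVar X"
  shows "head_of (mu X A) (hsubst (FVar(X := mu X A)) H)"
  using head_of_tsubst[of A H "mu X A" X] assms head_of_mu te_mu by blast

lemma spine_tsubst:
  assumes "tyexp U"
  shows "spine_of (tsubst X U A) =
    (case spine_of A of SFree n Y \<Rightarrow> if Y = X then slats n (spine_of U) else SFree n Y | r \<Rightarrow> r)"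
  unfolding tsubst_eq_psubst using assms
  by (subst spine_psubst) (auto simp: lcty_tyexp split: spine.splits)

text \<open>If \<open>A\<close> ends at \<open>X\<close>, properness puts a bullet above it and both
  sides are \<open>STop\<close>; otherwise the substitution does not touch the end of the
  spine.\<close>

lemma spine_unfold:
  assumes "tyexp A" "proper X A"
  shows "spine_of (tsubst X (mu X A) A) = spine_of (mu X A)"
  using spine_tyexp[OF assms(1)] assms proper_spine[OF assms(2)] spine_tsubst[OF te_mu[OF assms]]
  by (auto simp: spine_mu_SFree spine_mu_STop)

lemma head_of_tyexp: "head_of A H \<Longrightarrow> tyexp A \<Longrightarrow> H = HArr B C \<Longrightarrow> tyexp B \<and> tyexp C"
proof (induction arbitrary: B C rule: head_of.induct)
  case (ho_lat A H)
  then show ?case by (cases H) (auto dest: tyexp_LatD intro: te_lat)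
next
  case (ho_mu A H)
  have "tyexp (topen 0 (Mu A) A)"
    using ho_mu.prems(1) tyexp_tsubst[OF _ ho_mu.prems(1)] by (elim tyexp_MuE) simp
  then show ?case using ho_mu.IH ho_mu.prems by blast
qed (auto dest: tyexp_ArrD)

lemma head_of_HVar_spine:
  "head_of A H \<Longrightarrow> tyexp A \<Longrightarrow> H = HVar X \<Longrightarrow> \<exists>n. spine_of A = SFree n X"
proof (induction rule: head_of.induct)
  case (ho_lat A H)
  then show ?case by (cases H) (auto dest!: tyexp_LatD)
next
  case (ho_mu A H)
  from ho_mu.prems(1) obtain Y B where B: "Mu A = mu Y B" "tyexp B" "proper Y B"
    "topen 0 (Mu A) A = tsubst Y (Mu A) B" by (rule tyexp_MuE)
  then have "tyexp (topen 0 (Mu A) A)" "spine_of (topen 0 (Mu A) A) = spine_of (Mu A)"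
    using ho_mu.prems(1) spine_unfold[of B Y] by (simp_all add: tyexp_tsubst)
  then show ?case using ho_mu.IH ho_mu.prems by simp
qed (auto dest: tyexp_ArrD)

lemma head_of_exists: "tyexp A \<Longrightarrow> spine_of A \<noteq> STop \<Longrightarrow> \<exists>H. head_of A H"
proof (induction rule: tyexp.induct)
  case (te_mu A X)
  then have "spine_of A \<noteq> STop" using spine_mu_STop by blast
  with te_mu.IH obtain H where H: "head_of A H" by blast
  \<comment> \<open>A head equal to the bound variable would make the recursion a
    \<open>\<top>\<close>-variant.\<close>
  have "H \<noteq> HVar X"
  proof
    assume "H = HVar X"
    then obtain n where "spine_of A = SFree n X"
      using head_of_HVar_spine[OF H] te_mu.hyps by blast
    then show False
      using te_mu.prems proper_spine[OF te_mu.hyps(2)] by (simp add: spine_mu_SFree)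
  qed
  then show ?case using H head_of_mu_subst te_mu.hyps by blast
qed (auto intro: head_of.intros)

lemma tsim_spine: "tsim A B \<Longrightarrow> spine_of A = spine_of B"
proof (induction rule: tsim.induct)
  case (ts_unfold A X)
  then show ?case using spine_unfold by simp
next
  case (ts_fix A X C)
  then have A: "tyexp A" using tsim_tyexp by blast
  show ?case
  proof (cases "spine_of C = STop")
    case True
    then show ?thesis using ts_fix.IH[unfolded spine_tsubst[OF A]] by (simp add: spine_mu_STop)
  next
    case False
    then obtain n Y where C: "spine_of C = SFree n Y" using tyexp_SFreeE ts_fix.hyps by blast
    have eq: "spine_of A = (if Y = X then slats n (spine_of A) else SFree n Y)"
      using ts_fix.IH[unfolded spine_tsubst[OF A]] C by simp
    show ?thesis
    proof (cases "Y = X")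
      case True
      \<comment> \<open>Here the spine of \<open>A\<close> equals itself with \<open>n\<close> more
        bullets, where properness gives \<open>n \<noteq> 0\<close>; no \<open>SFree\<close>
        satisfies this.\<close>
      have "spine_of A = STop"
      proof (rule ccontr)
        assume "spine_of A \<noteq> STop"
        then obtain m Z where "spine_of A = SFree m Z" using tyexp_SFreeE A by blast
        then show False
          using eq C True proper_spine[of X C n] ts_fix.hyps by simp
      qed
      then show ?thesis
        using C True proper_spine[of X C n] ts_fix.hyps by (simp add: spine_mu_SFree)
    next
      case False
      then show ?thesis using eq C by (simp add: spine_mu_SFree)
    qed
  qed
qed auto

text \<open>Which variable ends a type is settled by \<open>tsim_spine\<close>, so any two variables
  count as related; only a clash between variable and arrow is excluded.\<close>

fun hsim :: "head \<Rightarrow> head \<Rightarrow> bool" where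
  "hsim (HVar X) (HVar Y) = True"
| "hsim (HArr A B) (HArr C D) = (tsim A C \<and> tsim B D)"
| "hsim _ _ = False"

lemma hsim_sym: "hsim H K \<Longrightarrow> hsim K H"
  by (cases H; cases K) (simp_all, metis ts_sym)

lemma hsim_trans: "hsim H K \<Longrightarrow> hsim K L \<Longrightarrow> hsim H L"
proof (cases H; cases K; cases L)
  fix A B C D E F
  assume "hsim H K" "hsim K L" and *: "H = HArr A B" "K = HArr C D" "L = HArr E F"
  then have "tsim A C" "tsim C E" "tsim B D" "tsim D F" by simp_all
  then show "hsim H L" using * ts_trans[of A C E] ts_trans[of B D F] by simp
qed simp_all

lemma hsim_hlat: "hsim H K \<Longrightarrow> hsim (hlat H) (hlat K)"
  by (cases H; cases K) (simp_all add: ts_lat)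

lemma hsim_refl:
  assumes "head_of A H" "tyexp A"
  shows "hsim H H"
proof (cases H)
  case (HArr B C)
  then show ?thesis using head_of_tyexp[OF assms HArr] ts_refl by simp
qed simp

text \<open>By \<open>tsim_spine\<close> the exclusion of \<open>\<top>\<close>-variants passes to
  every intermediate type, which therefore has a head; it also makes the rule for
  \<open>Arr A top\<close> vacuous.\<close>

lemma tsim_heads:
  "tsim A B \<Longrightarrow> spine_of A \<noteq> STop \<Longrightarrow> head_of A H \<Longrightarrow> head_of B K \<Longrightarrow> hsim H K"
proof (induction arbitrary: H K rule: tsim.induct)
  case (ts_refl A)
  then show ?case using hsim_refl head_of_unique by metis
next
  case (ts_sym A B)
  then show ?case using tsim_spine hsim_sym by metis
next
  case (ts_trans A B C)
  then obtain L where "head_of B L"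
    using head_of_exists tsim_tyexp tsim_spine by metis
  then show ?case using ts_trans tsim_spine hsim_trans by metis
next
  case (ts_unfold A X)
  then have "head_of (mu X A) K" using head_of_mu by blast
  then show ?case
    using ts_unfold head_of_unique hsim_refl te_mu by metis
next
  case (ts_fix A X C)
  have A: "tyexp A" using ts_fix tsim_tyexp by blast
  have AC: "tsim A (mu X C)" using ts_fix tsim.ts_fix by blast
  have spA: "spine_of A = spine_of (tsubst X A C)" using ts_fix tsim_spine by blast
  have "spine_of C \<noteq> STop"
    using tsim_spine[OF AC] ts_fix.prems spine_mu_STop by metis
  then obtain L where L: "head_of C L"
    using head_of_exists ts_fix.hyps by blast
  \<comment> \<open>Otherwise the spine of \<open>A\<close> would equal itself with extra
    bullets.\<close>
  have X: "L \<noteq> HVar X"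
  proof
    assume "L = HVar X"
    then obtain n where n: "spine_of C = SFree n X"
      using head_of_HVar_spine[OF L] ts_fix.hyps by blast
    obtain m Y where "spine_of A = SFree m Y"
      using tyexp_SFreeE A ts_fix.prems by blast
    with n spA spine_tsubst[OF A, of X C] proper_spine[OF \<open>proper X C\<close> n]
    show False by simp
  qed
  have 1: "hsim H (hsubst (FVar(X := A)) L)"
    by (rule ts_fix.IH[OF ts_fix.prems(1,2) head_of_tsubst[OF L A X]])
  have K: "K = hsubst (FVar(X := mu X C)) L"
    by (rule head_of_unique[OF ts_fix.prems(3) head_of_mu_subst[OF L ts_fix.hyps(2,3) X]])
  \<comment> \<open>The two heads differ only in \<open>A\<close> against \<open>mu X C\<close>,
    which are equal by the rule at hand.\<close>
  have "hsim (hsubst (FVar(X := A)) L) (hsubst (FVar(X := mu X C)) L)"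
  proof (cases L)
    case (HArr D E)
    then show ?thesis
      using head_of_tyexp[OF L ts_fix.hyps(2) HArr] tsim_tsubst_cong[OF _ AC, of _ X]
      by (simp add: tsubst_eq_psubst)
  qed simp
  with 1 K show ?case using hsim_trans by blast
next
  case (ts_distr A B)
  then show ?case
    by (auto elim!: head_of_LatE head_of_ArrE simp: tsim.ts_refl tyexp.te_lat)
qed (auto elim!: head_of_LatE head_of_ArrE intro: hsim_hlat)


section \<open>Inversion of subtyping\<close>

lemma wf_sa_subset: "wf_sa g' \<Longrightarrow> g \<subseteq> g' \<Longrightarrow> wf_sa g"
  unfolding wf_sa_def by (blast intro: finite_subset)

lemma sub_wf: "sub g A B \<Longrightarrow> wf_sa g \<and> tyexp A \<and> tyexp B"
  by (induction rule: sub.induct)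
    (auto intro: tyexp.intros tyexp_top wf_sa_subset[of "insert _ _"] dest: tsim_tyexp)

lemma sub_refl: "wf_sa g \<Longrightarrow> tyexp A \<Longrightarrow> sub g A A"
  by (simp add: sub_sim ts_refl)

text \<open>Transitivity joins the two assumption sets, so composing with reflexivity over the
  larger set weakens.\<close>

lemma sub_weaken:
  assumes "sub g A B" "g \<subseteq> g'" "wf_sa g'"
  shows "sub g' A B"
  using sub_trans[OF assms(1) sub_refl[OF assms(3)]] sub_wf[OF assms(1)] assms
  by (simp add: Un_absorb1)

lemma sub_trans': "sub g A B \<Longrightarrow> sub g B C \<Longrightarrow> sub g A C"
  using sub_trans[of g A B g C] sub_wf by simp

lemma sub_lats: "sub g A B \<Longrightarrow> sub g (lats k A) (lats k B)"
  by (induction k) (auto intro: sub_lat)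

lemma sub_lats_later: "wf_sa g \<Longrightarrow> tyexp A \<Longrightarrow> sub g A (lats k A)"
proof (induction k)
  case (Suc k)
  then show ?case using sub_trans'[OF _ sub_later] tyexp_lats by simp
qed (simp add: sub_refl)

lemma wf_sa_insert:
  assumes "X \<notin> FTV_sa g" "Y \<notin> FTV_sa g" "X \<noteq> Y" "wf_sa g"
  shows "wf_sa (insert (X, Y) g)"
proof -
  have "{X, Y} \<inter> {fst q, snd q} = {}" if "q \<in> g" for q
    using that assms(1,2) unfolding FTV_sa_def by blast
  then show ?thesis
    using assms(3,4) unfolding wf_sa_def by (simp add: Int_commute, metis)
qed

text \<open>Assumptions may be replaced by derivations. This later lets the bound variables of two
  compared recursions be replaced by the recursive types themselves.\<close>

lemma sub_psubst:
  assumes "sub g A B" "wf_sa g'" "\<And>X. tyexp (s X)" "\<And>X Y. (X, Y) \<in> g \<Longrightarrow> sub g' (s X) (s Y)"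
  shows "sub g' (psubst s A) (psubst s B)"
  using assms
proof (induction arbitrary: s g' rule: sub.induct)
  case (sub_trans g1 A B g2 C)
  have "sub g' (psubst s A) (psubst s B)"
    by (rule sub_trans.IH(1)) (simp_all add: sub_trans.prems)
  moreover have "sub g' (psubst s B) (psubst s C)"
    by (rule sub_trans.IH(2)) (simp_all add: sub_trans.prems)
  ultimately show ?case by (rule sub_trans')
next
  case (sub_arr g1 A' A g2 B B')
  have "sub g' (psubst s A') (psubst s A)"
    by (rule sub_arr.IH(1)) (simp_all add: sub_arr.prems)
  moreover have "sub g' (psubst s B) (psubst s B')"
    by (rule sub_arr.IH(2)) (simp_all add: sub_arr.prems)
  ultimately show ?case
    using sub.sub_arr[of g' _ _ g'] sub_arr.prems(1) by simp
next
  case (sub_lat g A B)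
  then show ?case by (simp add: sub.sub_lat)
next
  case (sub_mu X Y g A B)
  have XY: "X \<noteq> Y" using sub_mu.hyps(2) unfolding wf_sa_def by auto
  have lc: "lcty 0 (s Z)" for Z using sub_mu.prems(2) by (rule lcty_tyexp)
  define F where "F = FTV_sa g' \<union> (\<Union>Z\<in>ftv A \<union> ftv B. ftv (s Z))"
  have F: "finite F"
    using sub_mu.prems(1) unfolding F_def FTV_sa_def wf_sa_def by auto
  from F obtain X' where X': "X' \<notin> F" by (rule fresh_nat)
  have "finite (insert X' F)" using F by simp
  then obtain Y' where Y': "Y' \<notin> insert X' F" by (rule fresh_nat)
  let ?s = "s(X := FVar X', Y := FVar Y')"
  \<comment> \<open>\<open>Y\<close> is not free in \<open>A\<close>, nor \<open>X\<close> in
    \<open>B\<close>, so one substitution renaming both binders serves both bodies.\<close>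
  have A: "psubst (s(X := FVar X')) A = psubst ?s A"
    using sub_mu.hyps(3,4) by (intro psubst_cong) auto
  have B: "psubst (s(Y := FVar Y')) B = psubst ?s B"
    using sub_mu.hyps(3,4) by (intro psubst_cong) auto
  have "psubst s (mu X A) = mu X' (psubst ?s A)"
    unfolding A[symmetric] using X' by (intro psubst_mu) (auto simp: F_def)
  moreover have "psubst s (mu Y B) = mu Y' (psubst ?s B)"
    unfolding B[symmetric] using Y' by (intro psubst_mu) (auto simp: F_def)
  moreover have "proper X' (psubst ?s A)"
    unfolding A[symmetric] using X' sub_mu.hyps(5) lc
    by (intro proper_psubst[of X]) (auto simp: F_def)
  moreover have "proper Y' (psubst ?s B)"
    unfolding B[symmetric] using Y' sub_mu.hyps(6) lc
    by (intro proper_psubst[of Y]) (auto simp: F_def)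
  moreover have wf: "wf_sa (insert (X', Y') g')"
    using X' Y' sub_mu.prems(1) by (intro wf_sa_insert) (auto simp: F_def)
  moreover have "sub (insert (X', Y') g') (psubst ?s A) (psubst ?s B)"
  proof (rule sub_mu.IH[OF wf])
    show "tyexp (?s Z)" for Z using sub_mu.prems(2) by (simp add: te_var)
    fix Z W assume "(Z, W) \<in> insert (X, Y) g"
    then consider "Z = X" "W = Y" | "(Z, W) \<in> g" by blast
    then show "sub (insert (X', Y') g') (?s Z) (?s W)"
    proof cases
      case 1
      then show ?thesis using XY sub_assm[OF wf] by simp
    next
      case 2
      then have "Z \<in> FTV_sa g" "W \<in> FTV_sa g" unfolding FTV_sa_def by force+
      then have "?s Z = s Z" "?s W = s W" using sub_mu.hyps(3,4) by auto
      then show ?thesis using sub_weaken[OF sub_mu.prems(3)[OF 2] subset_insertI wf] by simp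
    qed
  qed
  moreover have "X' \<notin> FTV_sa g' \<union> ftv (psubst ?s B)"
    unfolding B[symmetric] using X' Y' by (auto simp: ftv_psubst F_def)
  moreover have "Y' \<notin> FTV_sa g' \<union> ftv (psubst ?s A)"
    unfolding A[symmetric] using X' Y' by (auto simp: ftv_psubst F_def)
  ultimately show ?case
    using sub.sub_mu[of X' Y' g' "psubst ?s A" "psubst ?s B"] by simp
qed (simp_all add: sub_top sub_sim sub_later tyexp_psubst tsim_psubst)

lemma wf_sa_insert_unique:
  assumes "wf_sa (insert (X, Y) g)" "(Z, W) \<in> insert (X, Y) g"
  shows "Z = X \<longleftrightarrow> W = Y"
  using assms unfolding wf_sa_def by fastforce

lemma spine_ftv: "spine_of A = SFree n X \<Longrightarrow> X \<in> ftv A"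
proof (induction A arbitrary: n)
  case (Lat A)
  then show ?case by (cases "spine_of A") auto
next
  case (Mu A)
  then show ?case by (cases "spine_of A") (auto split: nat.splits if_splits)
qed auto

lemma sub_spine:
  "sub g A B \<Longrightarrow> spine_of B = STop \<or>
     (\<exists>n m X Y. spine_of A = SFree n X \<and> spine_of B = SFree m Y \<and> (X = Y \<or> (X, Y) \<in> g))"
proof (induction rule: sub.induct)
  case (sub_sim g A B)
  have "spine_of A = spine_of B" "tyexp B" using sub_sim tsim_spine tsim_tyexp by blast+
  then show ?case using spine_tyexp[of B] by metis
next
  case (sub_trans g1 A B g2 C)
  \<comment> \<open>A variable occurs at most once in an assumption set, so two assumptions never
    chain into a new pair.\<close>
  have XYZ: "X = Y \<or> Y = Z" if "(X, Y) \<in> g1" "(Y, Z) \<in> g2" for X Y Z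
  proof (rule ccontr)
    assume "\<not> (X = Y \<or> Y = Z)"
    then have "(X, Y) \<noteq> (Y, Z)" by simp
    then have "{fst (X, Y), snd (X, Y)} \<inter> {fst (Y, Z), snd (Y, Z)} = {}"
      using sub_trans.hyps(3) that unfolding wf_sa_def by blast
    then show False by simp
  qed
  show ?case
  proof (cases "spine_of C = STop")
    case False
    then obtain n m X Y where 1: "spine_of B = SFree n X" "spine_of C = SFree m Y"
      "X = Y \<or> (X, Y) \<in> g2"
      using sub_trans.IH(2) by blast
    then obtain k Z where 2: "spine_of A = SFree k Z" "Z = X \<or> (Z, X) \<in> g1"
      using sub_trans.IH(1) by auto
    have "Z = Y \<or> (Z, Y) \<in> g1 \<union> g2"
      using 1(3) 2(2) XYZ by blast
    with 1 2 show ?thesis by simp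
  qed simp
next
  case (sub_lat g A B)
  then show ?case by auto
next
  case (sub_mu X Y g A B)
  show ?case
  proof (cases "spine_of B = STop")
    case True
    then show ?thesis by (simp add: spine_mu_STop)
  next
    case False
    then obtain n m Z W where A: "spine_of A = SFree n Z" and B: "spine_of B = SFree m W"
      and "Z = W \<or> (Z, W) \<in> insert (X, Y) g"
      using sub_mu.IH by blast
    \<comment> \<open>The side conditions on \<open>X\<close> and \<open>Y\<close> leave three
      possibilities: a common variable not bound here, the two bound variables facing each other, or
      a pair of \<open>g\<close>.\<close>
    then consider "Z = W" "Z \<noteq> X" "Z \<noteq> Y" | "Z = X" "W = Y" | "(Z, W) \<in> g" "Z \<noteq> X" "W \<noteq> Y"
      using spine_ftv[OF A] spine_ftv[OF B] sub_mu.hyps(3,4)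
        wf_sa_insert_unique[OF sub_mu.hyps(2), of Z W]
      by blast
    then show ?thesis
    proof cases
      case 2
      then show ?thesis using B proper_spine[OF sub_mu.hyps(6)] by (simp add: spine_mu_SFree)
    qed (use A B in \<open>simp_all add: spine_mu_SFree\<close>)
  qed
next
  case (sub_later g A)
  then show ?case using spine_tyexp[of A] by auto
qed auto

text \<open>By \<open>X \<preceq> \<bullet>X\<close> and distribution,
  \<open>A \<rightarrow> B\<close> lies below
  \<open>\<bullet>\<^sup>k A \<rightarrow> \<bullet>\<^sup>k B\<close>; the components are compared
  after that step, contravariantly on the left.\<close>

fun hsub :: "(nat \<times> nat) set \<Rightarrow> head \<Rightarrow> head \<Rightarrow> bool" where
  "hsub g (HVar X) (HVar Y) = True"
| "hsub g (HArr A B) (HArr C D) = (\<exists>k. sub g C (lats k A) \<and> sub g (lats k B) D)"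
| "hsub g _ _ = False"

text \<open>The bullet counts add up, once the first pair of inequalities is prefixed with the
  \<open>l\<close> bullets of the second.\<close>

lemma hsub_trans: "hsub g H K \<Longrightarrow> hsub g K L \<Longrightarrow> hsub g H L"
proof (cases H; cases K; cases L)
  fix A B C D E F
  assume "hsub g H K" "hsub g K L" and *: "H = HArr A B" "K = HArr C D" "L = HArr E F"
  then obtain k l where
    "sub g C (lats k A)" "sub g (lats k B) D" "sub g E (lats l C)" "sub g (lats l D) F"
    by auto
  then have "sub g E (lats (l + k) A)" "sub g (lats (l + k) B) F"
    unfolding lats_lats[symmetric] by (blast intro: sub_trans' sub_lats)+
  then show "hsub g H L" using * by auto
qed auto

lemma hsub_hlat: "hsub g H K \<Longrightarrow> hsub g (hlat H) (hlat K)"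
  by (induction g H K rule: hsub.induct) (auto simp: lats_Lat intro: sub_lat)

lemma hsub_weaken: "hsub g H K \<Longrightarrow> g \<subseteq> g' \<Longrightarrow> wf_sa g' \<Longrightarrow> hsub g' H K"
  by (induction g H K rule: hsub.induct) (auto intro: sub_weaken)

lemma hsim_hsub: "hsim H K \<Longrightarrow> wf_sa g \<Longrightarrow> hsub g H K"
  by (induction H K rule: hsim.induct) (auto intro!: exI[of _ 0] sub_sim intro: ts_sym)

lemma psubst_lats: "psubst s (lats k A) = lats k (psubst s A)"
  by (induction k) auto

lemma head_of_ftv: "head_of A H \<Longrightarrow> H = HArr B C \<Longrightarrow> ftv B \<union> ftv C \<subseteq> ftv A"
proof (induction arbitrary: B C rule: head_of.induct)
  case (ho_lat A H)
  then show ?case by (cases H) auto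
next
  case (ho_mu A H)
  have "ftv (topen k U A) \<subseteq> ftv A \<union> ftv U" for k U
    by (induction A arbitrary: k) auto
  from this[of 0 "Mu A"] show ?case using ho_mu.IH[OF ho_mu.prems] by auto
qed auto

lemma sub_heads:
  "sub g A B \<Longrightarrow> spine_of B \<noteq> STop \<Longrightarrow> head_of A H \<Longrightarrow> head_of B K \<Longrightarrow> hsub g H K"
proof (induction arbitrary: H K rule: sub.induct)
  case (sub_assm X Y g)
  then show ?case by (auto elim!: head_of_FVarE)
next
  case (sub_sim g A B)
  then show ?case using tsim_heads tsim_spine hsim_hsub by metis
next
  case (sub_trans g1 A B g2 C)
  \<comment> \<open>Only \<open>\<top>\<close>-variants lie above a \<open>\<top>\<close>-variant,
    so the middle type has a head.\<close>
  have "spine_of B \<noteq> STop" using sub_spine[OF sub_trans.hyps(2)] sub_trans.prems by auto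
  then obtain L where "head_of B L"
    using head_of_exists sub_wf sub_trans.hyps by blast
  then have "hsub g1 H L" "hsub g2 L K"
    using sub_trans.IH sub_trans.prems \<open>spine_of B \<noteq> STop\<close> by blast+
  then show ?case
    using hsub_trans[OF hsub_weaken hsub_weaken] sub_trans.hyps(3) by blast
next
  case (sub_lat g A B)
  then show ?case by (auto elim!: head_of_LatE intro: hsub_hlat)
next
  case (sub_arr g1 A' A g2 B B')
  then have "sub (g1 \<union> g2) A' (lats 0 A)" "sub (g1 \<union> g2) (lats 0 B) B'"
    by (auto intro: sub_weaken)
  then show ?case
    using sub_arr.prems by (auto elim!: head_of_ArrE simp del: lats_0)
next
  case (sub_mu X Y g A B)
  have tyA: "tyexp A" and tyB: "tyexp B" using sub_wf[OF sub_mu.hyps(1)] by auto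
  have XY: "X \<noteq> Y" using sub_mu.hyps(2) unfolding wf_sa_def by auto
  have mu: "sub g (mu X A) (mu Y B)" using sub_mu.hyps by (rule sub.sub_mu)
  have wf: "wf_sa g" using mu sub_wf by blast
  have spB: "spine_of B \<noteq> STop" using sub_mu.prems spine_mu_STop by metis
  then have spA: "spine_of A \<noteq> STop" using sub_spine[OF sub_mu.hyps(1)] by auto
  have spmA: "spine_of (mu X A) \<noteq> STop" using sub_spine[OF mu] sub_mu.prems by auto
  obtain H' where H': "head_of A H'" using head_of_exists tyA spA by blast
  obtain K' where K': "head_of B K'" using head_of_exists tyB spB by blast
  \<comment> \<open>Were the bound variable the head of the body, the recursion would be a
    \<open>\<top>\<close>-variant.\<close>
  have hn: "L \<noteq> HVar Z"
    if L: "head_of C L" "tyexp C" "proper Z C" "spine_of (mu Z C) \<noteq> STop" for C L Z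
  proof
    assume "L = HVar Z"
    then obtain n where n: "spine_of C = SFree n Z"
      using head_of_HVar_spine[OF L(1,2)] by blast
    then show False using L(4) proper_spine[OF L(3) n] by (simp add: spine_mu_SFree)
  qed
  have H: "H = hsubst (FVar(X := mu X A)) H'"
    by (rule head_of_unique[OF sub_mu.prems(2) head_of_mu_subst[OF H' tyA sub_mu.hyps(5)
      hn[OF H' tyA sub_mu.hyps(5) spmA]]])
  have K: "K = hsubst (FVar(Y := mu Y B)) K'"
    by (rule head_of_unique[OF sub_mu.prems(3) head_of_mu_subst[OF K' tyB sub_mu.hyps(6)
      hn[OF K' tyB sub_mu.hyps(6) sub_mu.prems(1)]]])
  have "hsub (insert (X, Y) g) H' K'"
    using sub_mu.IH[OF spB H' K'] .
  show ?case
  proof (cases H'; cases K')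
    fix A1 A2 B1 B2 assume eq: "H' = HArr A1 A2" "K' = HArr B1 B2"
    with \<open>hsub _ H' K'\<close> obtain k where
      k: "sub (insert (X, Y) g) B1 (lats k A1)" "sub (insert (X, Y) g) (lats k A2) B2"
      by auto
    \<comment> \<open>Both bound variables are replaced by their recursive types at once; the
      assumption \<open>X \<preceq> Y\<close> becomes the very judgment \<open>mu\<close> concluded
      by this rule.\<close>
    let ?s = "FVar(X := mu X A, Y := mu Y B)"
    have psub: "sub g (psubst ?s C) (psubst ?s D)" if "sub (insert (X, Y) g) C D" for C D
    proof (rule sub_psubst[OF that wf])
      show "tyexp (?s Z)" for Z using sub_wf[OF mu] by (simp add: te_var)
      show "sub g (?s Z) (?s W)" if "(Z, W) \<in> insert (X, Y) g" for Z W
      proof (cases "(Z, W) = (X, Y)")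
        case True
        then show ?thesis using XY mu by simp
      next
        case False
        then have ZW: "(Z, W) \<in> g" using that by blast
        then have "Z \<in> FTV_sa g" "W \<in> FTV_sa g" unfolding FTV_sa_def by force+
        then have "?s Z = FVar Z" "?s W = FVar W" using sub_mu.hyps(3,4) by auto
        then show ?thesis
          using ZW wf sub_assm[of Z W g] by (simp add: insert_absorb)
      qed
    qed
    have "psubst (FVar(X := mu X A)) C = psubst ?s C" if "ftv C \<subseteq> ftv A" for C
      using that sub_mu.hyps(3,4) by (intro psubst_cong) auto
    moreover have "psubst (FVar(Y := mu Y B)) C = psubst ?s C" if "ftv C \<subseteq> ftv B" for C
      using that sub_mu.hyps(3,4) by (intro psubst_cong) auto
    ultimately show ?thesis
      using psub[OF k(1)] psub[OF k(2)] head_of_ftv[OF H' eq(1)] head_of_ftv[OF K' eq(2)] H K eq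
      by (auto simp: psubst_lats)
  qed (use \<open>hsub _ H' K'\<close> H K in auto)
next
  case (sub_later g A)
  then have K: "K = hlat H" using head_of_unique by (auto elim!: head_of_LatE)
  show ?case
  proof (cases H)
    case (HArr B C)
    then have "tyexp B" "tyexp C" using head_of_tyexp[OF sub_later.prems(2) sub_later.hyps(2)] by auto
    \<comment> \<open>The witness is \<open>k = 1\<close>: the head of \<open>Lat A\<close> carries
      one more bullet on each component.\<close>
    then have "sub g (Lat B) (lats 1 B)" "sub g (lats 1 C) (Lat C)"
      using sub_later by (auto intro: sub_refl te_lat)
    then show ?thesis using K HArr by (auto simp del: lats_Suc)
  qed (use K in simp)
qed auto

lemma sub_Arr_inversion:
  assumes "subtype (Arr A B) (Arr C D)" "spine_of D \<noteq> STop"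
  shows "\<exists>k. subtype C (lats k A) \<and> subtype (lats k B) D"
  using sub_heads[OF assms(1), of "HArr A B" "HArr C D"] assms(2) by (auto intro: ho_arr)


section \<open>Terms\<close>

fun fv :: "trm \<Rightarrow> nat set" where
  "fv (Var x) = {x}"
| "fv (BV i) = {}"
| "fv (Abs M) = fv M"
| "fv (App M N) = fv M \<union> fv N"

fun mopen :: "nat \<Rightarrow> trm \<Rightarrow> trm \<Rightarrow> trm" where
  "mopen k U (Var x) = Var x"
| "mopen k U (BV i) = (if i = k then U else BV i)"
| "mopen k U (Abs M) = Abs (mopen (Suc k) U M)"
| "mopen k U (App M N) = App (mopen k U M) (mopen k U N)"

fun mpsubst :: "(nat \<Rightarrow> trm) \<Rightarrow> trm \<Rightarrow> trm" where
  "mpsubst s (Var x) = s x"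
| "mpsubst s (BV i) = BV i"
| "mpsubst s (Abs M) = Abs (mpsubst s M)"
| "mpsubst s (App M N) = App (mpsubst s M) (mpsubst s N)"

lemma finite_fv [simp]: "finite (fv M)"
  by (induction M) auto

lemma msubst_eq_mpsubst: "msubst x N M = mpsubst (Var(x := N)) M"
  by (induction M) auto

lemma mpsubst_cong: "(\<And>x. x \<in> fv M \<Longrightarrow> s x = t x) \<Longrightarrow> mpsubst s M = mpsubst t M"
  by (induction M) auto

lemma mpsubst_Var [simp]: "mpsubst Var M = M"
  by (induction M) auto

lemma mpsubst_mpsubst: "mpsubst s (mpsubst t M) = mpsubst (\<lambda>x. mpsubst s (t x)) M"
  by (induction M) auto

lemma msubst_fresh: "x \<notin> fv M \<Longrightarrow> msubst x N M = M"
  by (induction M) auto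

lemma fv_mpsubst: "fv (mpsubst s M) = (\<Union>x\<in>fv M. fv (s x))"
  by (induction M) auto

lemma fv_mclose: "fv (mclose k x M) = fv M - {x}"
  by (induction M arbitrary: k) auto

lemma fv_lam [simp]: "fv (lam x M) = fv M - {x}"
  by (simp add: lam_def fv_mclose)

lemma mclose_fresh: "x \<notin> fv M \<Longrightarrow> mclose k x M = M"
  by (induction M arbitrary: k) auto

lemma mopen_mclose: "lc_at k M \<Longrightarrow> mopen k N (mclose k x M) = msubst x N M"
  by (induction M arbitrary: k) auto

lemma lc_at_mono: "lc_at k M \<Longrightarrow> k \<le> l \<Longrightarrow> lc_at l M"
proof (induction M arbitrary: k l)
  case (Abs M)
  then show ?case using Abs.IH[of "Suc k" "Suc l"] by simp
qed auto

lemma lc_at_mclose: "lc_at k M \<Longrightarrow> lc_at (Suc k) (mclose k x M)"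
  by (induction M arbitrary: k) auto

lemma lc_lam: "lc M \<Longrightarrow> lc (lam x M)"
  by (simp add: lam_def lc_at_mclose)

lemma lc_at_mpsubst:
  assumes "\<And>x. lc (s x)"
  shows "lc_at k M \<Longrightarrow> lc_at k (mpsubst s M)"
proof (induction M arbitrary: k)
  case (Var x)
  then show ?case using lc_at_mono[OF assms] by simp
qed auto

lemma lc_msubst: "lc M \<Longrightarrow> lc N \<Longrightarrow> lc (msubst x N M)"
  unfolding msubst_eq_mpsubst by (rule lc_at_mpsubst) auto

text \<open>Both sides open the same locally nameless body with \<open>N\<close>, so contracting a
  redex does not depend on the bound name.\<close>

lemma lam_eq_msubst:
  assumes "lam x M = lam y M'" "lc M" "lc M'"
  shows "msubst x N M = msubst y N M'"
  using assms mopen_mclose[of 0 M N x] mopen_mclose[of 0 M' N y] by (simp add: lam_def)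

lemma mpsubst_mclose:
  assumes "\<And>z. z \<in> fv M \<Longrightarrow> z \<noteq> x \<Longrightarrow> x' \<notin> fv (s z)"
  shows "mpsubst s (mclose k x M) = mclose k x' (mpsubst (s(x := Var x')) M)"
  using assms by (induction M arbitrary: k) (auto simp: mclose_fresh)

lemma mpsubst_lam:
  assumes "\<And>z. z \<in> fv M \<Longrightarrow> z \<noteq> x \<Longrightarrow> x' \<notin> fv (s z)"
  shows "mpsubst s (lam x M) = lam x' (mpsubst (s(x := Var x')) M)"
  using mpsubst_mclose[OF assms] by (simp add: lam_def)

lemma mpsubst_msubst:
  assumes "\<And>z. z \<in> fv M \<Longrightarrow> z \<noteq> x \<Longrightarrow> x' \<notin> fv (s z)"
  shows "mpsubst s (msubst x N M) = msubst x' (mpsubst s N) (mpsubst (s(x := Var x')) M)"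
proof -
  have "s z = msubst x' (mpsubst s N) (s z)" if "z \<in> fv M" "z \<noteq> x" for z
    using that assms by (simp add: msubst_fresh)
  then show ?thesis
    unfolding msubst_eq_mpsubst mpsubst_mpsubst
    by (intro mpsubst_cong) auto
qed

lemma mpsubst_lam_fresh:
  assumes "finite F"
  obtains x' where "x' \<notin> F" "x' \<notin> (\<Union>z\<in>fv M. fv (s z))"
    "mpsubst s (lam x M) = lam x' (mpsubst (s(x := Var x')) M)"
proof -
  have "finite (F \<union> (\<Union>z\<in>fv M. fv (s z)))" using assms by simp
  then obtain x' where x': "x' \<notin> F \<union> (\<Union>z\<in>fv M. fv (s z))"
    by (rule fresh_nat)
  show thesis
  proof (rule that)
    show "mpsubst s (lam x M) = lam x' (mpsubst (s(x := Var x')) M)"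
      using x' by (intro mpsubst_lam) auto
  qed (use x' in auto)
qed

section \<open>Reduction and substitution\<close>

lemma beta_lc: "beta M L \<Longrightarrow> lc M \<and> lc L"
  by (induction rule: beta.induct) (auto simp: lc_lam lc_msubst)

lemma beta_fv: "beta M L \<Longrightarrow> fv L \<subseteq> fv M"
  by (induction rule: beta.induct)
    (auto simp: msubst_eq_mpsubst fv_mpsubst split: if_splits)

lemma beta_mpsubst:
  assumes "beta M L" "\<And>x. lc (s x)"
  shows "beta (mpsubst s M) (mpsubst s L)"
  using assms
proof (induction arbitrary: s rule: beta.induct)
  case (b_beta M N x)
  obtain x' where "x' \<notin> {}" and x': "x' \<notin> (\<Union>z\<in>fv M. fv (s z))"
    "mpsubst s (lam x M) = lam x' (mpsubst (s(x := Var x')) M)"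
    by (rule mpsubst_lam_fresh[OF finite.emptyI])
  have "lc (mpsubst (s(x := Var x')) M)" "lc (mpsubst s N)"
    using b_beta by (simp_all add: lc_at_mpsubst)
  moreover have "mpsubst s (msubst x N M) = msubst x' (mpsubst s N) (mpsubst (s(x := Var x')) M)"
    using x'(1) by (intro mpsubst_msubst) auto
  ultimately show ?case
    using x' beta.b_beta by simp
next
  case (b_abs M M' x)
  have "finite (\<Union>z\<in>fv M'. fv (s z))" by simp
  then obtain x' where x': "x' \<notin> (\<Union>z\<in>fv M'. fv (s z))"
    "x' \<notin> (\<Union>z\<in>fv M. fv (s z))" "mpsubst s (lam x M) = lam x' (mpsubst (s(x := Var x')) M)"
    by (rule mpsubst_lam_fresh)
  moreover have "mpsubst s (lam x M') = lam x' (mpsubst (s(x := Var x')) M')"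
    using x'(1) by (intro mpsubst_lam) auto
  moreover have "beta (mpsubst (s(x := Var x')) M) (mpsubst (s(x := Var x')) M')"
    using b_abs.prems by (intro b_abs.IH) simp
  ultimately show ?case
    by (simp add: beta.b_abs)
qed (simp_all add: b_app1 b_app2 lc_at_mpsubst)

text \<open>The rule may present the abstraction with another bound name \<open>y\<close>; renaming
  \<open>y\<close> to \<open>x\<close> in the reduct restores the given one.\<close>

lemma beta_lamE:
  assumes "beta (lam x M) L" "lc M"
  obtains M' where "L = lam x M'" "beta M M'"
  using assms(1)
proof (cases rule: beta.cases)
  case (b_abs N N' y)
  have lc: "lc N" "lc N'" using b_abs beta_lc by auto
  have "msubst x (Var x) M = msubst y (Var x) N"
    using lam_eq_msubst b_abs(1) assms(2) lc(1) by blast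
  then have M: "M = msubst y (Var x) N"
    by (simp add: msubst_eq_mpsubst)
  \<comment> \<open>Apart from \<open>y\<close> itself, \<open>x\<close> is not free in
    \<open>N\<close>, and reduction creates no free variables, so closing the renamed reduct over
    \<open>x\<close> captures nothing.\<close>
  have "fv N - {y} = fv M - {x}"
    using b_abs(1) fv_lam by metis
  then have "z \<noteq> x" if "z \<in> fv N'" "z \<noteq> y" for z
    using that beta_fv[OF b_abs(3)] by blast
  then have "mpsubst Var (lam y N') = lam x (mpsubst (Var(y := Var x)) N')"
    by (intro mpsubst_lam) auto
  then have "L = lam x (msubst y (Var x) N')"
    using b_abs(2) by (simp add: msubst_eq_mpsubst)
  moreover have "beta M (msubst y (Var x) N')"
    unfolding M msubst_eq_mpsubst using b_abs(3) by (rule beta_mpsubst) simp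
  ultimately show thesis by (rule that)
qed (simp_all add: lam_def)


section \<open>Structural properties of typing\<close>

lemma later_ctx_eq_Some: "later_ctx G x = Some B \<longleftrightarrow> (\<exists>A. G x = Some A \<and> B = Lat A)"
  by (auto simp: later_ctx_def)

lemma later_ctx_upd: "later_ctx (G(x \<mapsto> A)) = (later_ctx G)(x \<mapsto> Lat A)"
  by (rule ext) (simp add: later_ctx_def)

lemma later_ctx_map_add: "later_ctx (G1 ++ G2) = later_ctx G1 ++ later_ctx G2"
  by (rule ext) (simp add: later_ctx_def map_add_def split: option.split)

lemma later_ctx_funpow: "(later_ctx ^^ k) G x = map_option (lats k) (G x)"
  by (cases "G x"; induction k) (simp_all add: later_ctx_def)

lemma compat_later_ctx: "compat G1 G2 \<Longrightarrow> compat (later_ctx G1) (later_ctx G2)"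
  unfolding compat_def later_ctx_def by (auto simp: domIff)

lemma map_add_compat:
  assumes "compat G1 G2" "G1 x = Some A"
  shows "(G1 ++ G2) x = Some A"
proof (cases "x \<in> dom G2")
  case True
  then have "G2 x = Some A" using assms unfolding compat_def by (metis IntI domI)
  then show ?thesis by simp
next
  case False
  then show ?thesis using assms(2) by (simp add: map_add_dom_app_simps)
qed

lemma wf_ctx_tyexp: "wf_ctx G \<Longrightarrow> G x = Some A \<Longrightarrow> tyexp A"
  by (auto simp: wf_ctx_def ran_def)

lemma wf_ctxI: "finite (dom G) \<Longrightarrow> (\<And>x A. G x = Some A \<Longrightarrow> tyexp A) \<Longrightarrow> wf_ctx G"
  by (auto simp: wf_ctx_def ran_def)

lemma wf_ctx_finite: "wf_ctx G \<Longrightarrow> finite (dom G)"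
  by (simp add: wf_ctx_def)

lemma wf_later_ctx: "wf_ctx (later_ctx G) \<longleftrightarrow> wf_ctx G"
proof -
  have "dom (later_ctx G) = dom G" by (simp add: later_ctx_def dom_def)
  moreover have "ran (later_ctx G) = Lat ` ran G"
    by (auto simp: ran_def later_ctx_eq_Some)
  moreover have "tyexp (Lat A) \<longleftrightarrow> tyexp A" for A
    by (auto intro: te_lat dest: tyexp_LatD)
  ultimately show ?thesis
    by (simp add: wf_ctx_def)
qed

lemma wf_ctx_upd: "wf_ctx G \<Longrightarrow> tyexp A \<Longrightarrow> wf_ctx (G(x \<mapsto> A))"
  by (rule wf_ctxI) (auto dest: wf_ctx_finite wf_ctx_tyexp split: if_splits)

lemma wf_ctx_updD:
  assumes "wf_ctx (G(x \<mapsto> A))" "G x = None \<or> G x = Some A"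
  shows "wf_ctx G" "tyexp A"
proof -
  show "tyexp A" using wf_ctx_tyexp[OF assms(1), of x A] by simp
  show "wf_ctx G"
  proof (rule wf_ctxI)
    show "finite (dom G)" using wf_ctx_finite[OF assms(1)] by simp
    show "tyexp B" if "G y = Some B" for y B
      using that assms(2) \<open>tyexp A\<close> wf_ctx_tyexp[OF assms(1), of y B] by (cases "y = x") auto
  qed
qed

lemma wf_ctx_map_add: "wf_ctx G1 \<Longrightarrow> wf_ctx G2 \<Longrightarrow> wf_ctx (G1 ++ G2)"
  by (rule wf_ctxI) (auto dest: wf_ctx_finite wf_ctx_tyexp)

lemma typing_wf: "typing G M A \<Longrightarrow> wf_ctx G \<and> lc M \<and> tyexp A"
proof (induction rule: typing.induct)
  case (t_var G x A)
  then show ?case using wf_ctx_tyexp[of G x A] by simp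
next
  case (t_shift G M A)
  then show ?case by (simp add: wf_later_ctx tyexp_LatD)
next
  case (t_sub G M A B)
  then show ?case using sub_wf[OF t_sub.hyps(2)] by simp
next
  case (t_abs G x A M B)
  then show ?case using wf_ctx_updD[of G x A] lc_lam te_arr by blast
next
  case (t_app G1 M A B G2 N)
  then show ?case using tyexp_ArrD[of A B] by (simp add: wf_ctx_map_add)
qed (simp add: tyexp_top)

lemma typing_app:
  assumes "typing G M (Arr A B)" "typing G N A"
  shows "typing G (App M N) B"
proof -
  have "G ++ G = G" by (rule ext) (simp add: map_add_def split: option.split)
  then show ?thesis using t_app[OF assms] by (simp add: compat_def)
qed

text \<open>Weakening is proved for renamings because a bound name may clash with the larger context
  and must then be exchanged for a fresh one.\<close>

lemma typing_rename:
  assumes "typing G M A" "wf_ctx G'" "\<forall>x B. G x = Some B \<longrightarrow> G' (r x) = Some B"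
  shows "typing G' (mpsubst (\<lambda>x. Var (r x)) M) A"
  using assms
proof (induction arbitrary: r G' rule: typing.induct)
  case (t_var G x A)
  then show ?case by (simp add: typing.t_var)
next
  case (t_shift G M A)
  have "wf_ctx (later_ctx G')" using t_shift.prems by (simp add: wf_later_ctx)
  moreover have "\<forall>x B. later_ctx G x = Some B \<longrightarrow> later_ctx G' (r x) = Some B"
    using t_shift.prems(2) by (auto simp: later_ctx_eq_Some)
  ultimately have "typing (later_ctx G') (mpsubst (\<lambda>x. Var (r x)) M) (Lat A)"
    by (rule t_shift.IH)
  then show ?case by (rule typing.t_shift)
next
  case (t_top G M)
  then show ?case by (simp add: typing.t_top lc_at_mpsubst)
next
  case (t_sub G M A B)
  show ?case using t_sub.IH[OF t_sub.prems] t_sub.hyps(2) by (rule typing.t_sub)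
next
  case (t_abs G x A M B)
  obtain x' where x': "x' \<notin> dom G'" and "x' \<notin> (\<Union>z\<in>fv M. fv (Var (r z)))"
    and lam: "mpsubst (\<lambda>z. Var (r z)) (lam x M) = lam x' (mpsubst ((\<lambda>z. Var (r z))(x := Var x')) M)"
    by (rule mpsubst_lam_fresh[OF wf_ctx_finite[OF t_abs.prems(1)]])
  have "(\<lambda>z. Var (r z))(x := Var x') = (\<lambda>z. Var ((r(x := x')) z))"
    by auto
  moreover have "typing (G'(x' \<mapsto> A)) (mpsubst (\<lambda>z. Var ((r(x := x')) z)) M) B"
  proof (rule t_abs.IH)
    show "wf_ctx (G'(x' \<mapsto> A))"
      using typing_wf[OF t_abs.hyps(1)] wf_ctx_updD(2)[of G x A] t_abs.prems(1) t_abs.hyps(2)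
      by (blast intro: wf_ctx_upd)
    show "\<forall>z C. (G(x \<mapsto> A)) z = Some C \<longrightarrow> (G'(x' \<mapsto> A)) ((r(x := x')) z) = Some C"
      using t_abs.prems(2) x' by (auto simp: domIff)
  qed
  moreover have "G' x' = None" using x' by (simp add: domIff)
  ultimately show ?case
    using lam by (simp add: typing.t_abs)
next
  case (t_app G1 M A B G2 N)
  have "typing G' (mpsubst (\<lambda>x. Var (r x)) M) (Arr A B)"
    using t_app.prems map_add_compat[OF t_app.hyps(3)] by (intro t_app.IH(1)) auto
  moreover have "typing G' (mpsubst (\<lambda>x. Var (r x)) N) A"
    using t_app.prems by (intro t_app.IH(2)) auto
  ultimately show ?case
    using typing_app by simp
qed

lemma typing_weaken:
  assumes "typing G M A" "wf_ctx G'" "\<forall>x B. G x = Some B \<longrightarrow> G' x = Some B"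
  shows "typing G' M A"
  using typing_rename[OF assms(1,2), of "\<lambda>x. x"] assms(3) by simp

lemma sub_distr: "tyexp A \<Longrightarrow> tyexp B \<Longrightarrow> subtype (Lat (Arr A B)) (Arr (Lat A) (Lat B))"
  by (simp add: sub_sim ts_distr wf_sa_def)

lemma sub_distr_rev: "tyexp A \<Longrightarrow> tyexp B \<Longrightarrow> subtype (Arr (Lat A) (Lat B)) (Lat (Arr A B))"
  by (rule sub_sim[OF _ ts_sym[OF ts_distr]]) (simp_all add: wf_sa_def)

lemma sub_distr_lats:
  assumes "tyexp A" "tyexp B"
  shows "subtype (lats k (Arr A B)) (Arr (lats k A) (lats k B))"
proof (induction k)
  case 0
  then show ?case using assms by (simp add: sub_refl te_arr wf_sa_def)
next
  case (Suc k)
  have "subtype (Lat (lats k (Arr A B))) (Lat (Arr (lats k A) (lats k B)))"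
    using Suc by (rule sub_lat)
  moreover have "subtype (Lat (Arr (lats k A) (lats k B))) (Arr (Lat (lats k A)) (Lat (lats k B)))"
    using assms by (intro sub_distr tyexp_lats)
  ultimately show ?case unfolding lats_Suc by (rule sub_trans')
qed

text \<open>The distribution of bullets over arrows enters in both directions: folded for
  abstractions, expanded for applications.\<close>

lemma typing_later: "typing G M A \<Longrightarrow> typing (later_ctx G) M (Lat A)"
proof (induction rule: typing.induct)
  case (t_var G x A)
  then show ?case by (simp add: typing.t_var wf_later_ctx later_ctx_eq_Some)
next
  case (t_shift G M A)
  from t_shift.IH show ?case by (rule typing.t_shift)
next
  case (t_top G M)
  then have "typing (later_ctx G) M top" by (simp add: typing.t_top wf_later_ctx)
  moreover have "subtype top (Lat top)" by (simp add: sub_later tyexp_top wf_sa_def)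
  ultimately show ?case by (rule typing.t_sub)
next
  case (t_sub G M A B)
  show ?case using t_sub.IH sub_lat[OF t_sub.hyps(2)] by (rule typing.t_sub)
next
  case (t_abs G x A M B)
  have "later_ctx G x = None \<or> later_ctx G x = Some (Lat A)"
    using t_abs.hyps(2) by (auto simp: later_ctx_def)
  with t_abs.IH[unfolded later_ctx_upd] have "typing (later_ctx G) (lam x M) (Arr (Lat A) (Lat B))"
    by (rule typing.t_abs)
  moreover have "tyexp A" "tyexp B"
    using typing_wf[OF typing.t_abs[OF t_abs.hyps]] tyexp_ArrD by blast+
  ultimately show ?case by (intro typing.t_sub[OF _ sub_distr_rev])
next
  case (t_app G1 M A B G2 N)
  have "tyexp A" "tyexp B"
    using typing_wf[OF t_app.hyps(1)] tyexp_ArrD by blast+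
  then have "typing (later_ctx G1) M (Arr (Lat A) (Lat B))"
    by (intro typing.t_sub[OF t_app.IH(1) sub_distr])
  then show ?case
    unfolding later_ctx_map_add
    using t_app.IH(2) compat_later_ctx[OF t_app.hyps(3)] by (rule typing.t_app)
qed

lemma typing_subst:
  assumes "typing G M A" "wf_ctx G'" "\<forall>x. lc (s x)" "\<forall>x B. G x = Some B \<longrightarrow> typing G' (s x) B"
  shows "typing G' (mpsubst s M) A"
  using assms
proof (induction arbitrary: s G' rule: typing.induct)
  case (t_var G x A)
  then show ?case by simp
next
  case (t_shift G M A)
  have "wf_ctx (later_ctx G')" using t_shift.prems by (simp add: wf_later_ctx)
  \<comment> \<open>In the premise of a shift the substituted terms need delayed types in the
    delayed context, which \<open>typing_later\<close> supplies.\<close>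
  moreover have "\<forall>x B. later_ctx G x = Some B \<longrightarrow> typing (later_ctx G') (s x) B"
    using t_shift.prems(3) typing_later by (auto simp: later_ctx_eq_Some)
  ultimately have "typing (later_ctx G') (mpsubst s M) (Lat A)"
    using t_shift.prems(2) by (intro t_shift.IH)
  then show ?case by (rule typing.t_shift)
next
  case (t_top G M)
  then show ?case by (simp add: typing.t_top lc_at_mpsubst)
next
  case (t_sub G M A B)
  show ?case using t_sub.IH[OF t_sub.prems] t_sub.hyps(2) by (rule typing.t_sub)
next
  case (t_abs G x A M B)
  obtain x' where x': "x' \<notin> dom G'" and "x' \<notin> (\<Union>z\<in>fv M. fv (s z))"
    and lam: "mpsubst s (lam x M) = lam x' (mpsubst (s(x := Var x')) M)"
    by (rule mpsubst_lam_fresh[OF wf_ctx_finite[OF t_abs.prems(1)]])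
  have wf: "wf_ctx (G'(x' \<mapsto> A))"
    using typing_wf[OF t_abs.hyps(1)] wf_ctx_updD(2)[of G x A] t_abs.prems(1) t_abs.hyps(2)
    by (blast intro: wf_ctx_upd)
  have None: "G' x' = None" using x' by (simp add: domIff)
  have weaken: "typing (G'(x' \<mapsto> A)) N C" if "typing G' N C" for N C
    using None by (intro typing_weaken[OF that wf]) auto
  have "typing (G'(x' \<mapsto> A)) (mpsubst (s(x := Var x')) M) B"
  proof (rule t_abs.IH[OF wf])
    show "\<forall>z. lc ((s(x := Var x')) z)" using t_abs.prems(2) by simp
    have "typing (G'(x' \<mapsto> A)) (Var x') A" using wf by (rule typing.t_var) simp
    then show "\<forall>z C. (G(x \<mapsto> A)) z = Some C \<longrightarrow> typing (G'(x' \<mapsto> A)) ((s(x := Var x')) z) C"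
      using t_abs.prems(3) weaken by simp
  qed
  then show ?case
    using lam None by (simp add: typing.t_abs)
next
  case (t_app G1 M A B G2 N)
  have "typing G' (mpsubst s M) (Arr A B)"
    using t_app.prems map_add_compat[OF t_app.hyps(3)] by (intro t_app.IH(1)) auto
  moreover have "typing G' (mpsubst s N) A"
    using t_app.prems by (intro t_app.IH(2)) auto
  ultimately show ?case
    using typing_app by simp
qed

lemma typing_later_funpow: "typing G M A \<Longrightarrow> typing ((later_ctx ^^ k) G) M (lats k A)"
  by (induction k) (simp_all add: typing_later)

lemma typing_shift_funpow: "typing ((later_ctx ^^ k) G) M (lats k A) \<Longrightarrow> typing G M A"
proof (induction k)
  case (Suc k)
  then have "typing (later_ctx ((later_ctx ^^ k) G)) M (Lat (lats k A))"
    by simp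
  then have "typing ((later_ctx ^^ k) G) M (lats k A)"
    by (rule t_shift)
  then show ?case by (rule Suc.IH)
qed simp


section \<open>Subject reduction\<close>

text \<open>The \<open>k\<close> counts the uses of the shift rule below the introduction of the abstraction.\<close>

lemma typing_Abs_inversion:
  assumes "typing G T C" "T = Abs T'"
  shows "spine_of C = STop \<or>
    (\<exists>k x M A B. T = lam x M \<and> typing (((later_ctx ^^ k) G)(x \<mapsto> A)) M B \<and>
       subtype (Arr A B) (lats k C))"
  using assms
proof (induction rule: typing.induct)
  case (t_shift G M C)
  show ?case
  proof (cases "spine_of C = STop")
    case False
    then have "spine_of (Lat C) \<noteq> STop" by simp
    then obtain k x N A B where "M = lam x N"
      "typing (((later_ctx ^^ k) (later_ctx G))(x \<mapsto> A)) N B"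
      "subtype (Arr A B) (lats k (Lat C))"
      using t_shift.IH[OF t_shift.prems] by blast
    \<comment> \<open>The shift contributes one further bullet to both context and type.\<close>
    moreover have "(later_ctx ^^ k) (later_ctx G) = (later_ctx ^^ Suc k) G"
      by (simp add: funpow_swap1)
    moreover have "lats k (Lat C) = lats (Suc k) C"
      by (simp add: lats_Lat)
    ultimately show ?thesis by metis
  qed simp
next
  case (t_sub G M C D)
  show ?case
  proof (cases "spine_of D = STop")
    case False
    then have "spine_of C \<noteq> STop"
      using sub_spine[OF t_sub.hyps(2)] by auto
    then obtain k x N A B where "M = lam x N" "typing (((later_ctx ^^ k) G)(x \<mapsto> A)) N B"
      "subtype (Arr A B) (lats k C)"
      using t_sub.IH[OF t_sub.prems] by blast
    moreover have "subtype (lats k C) (lats k D)"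
      using t_sub.hyps(2) by (rule sub_lats)
    ultimately show ?thesis using sub_trans' by blast
  qed simp
next
  case (t_abs G x A M B)
  have "subtype (Arr A B) (lats 0 (Arr A B))"
    using typing_wf[OF typing.t_abs[OF t_abs.hyps]] by (simp add: sub_refl wf_sa_def)
  moreover have "typing (((later_ctx ^^ 0) G)(x \<mapsto> A)) M B"
    using t_abs.hyps(1) by simp
  ultimately show ?case by blast
qed simp_all

lemma typing_STop: "wf_ctx G \<Longrightarrow> lc M \<Longrightarrow> tyexp A \<Longrightarrow> spine_of A = STop \<Longrightarrow> typing G M A"
  by (rule t_sub[OF t_top sub_sim[OF _ ts_sym[OF tsim_top]]]) (simp_all add: wf_sa_def)

text \<open>If \<open>B\<close> is a \<open>\<top>\<close>-variant, every term has type
  \<open>B\<close>. Otherwise the inversions of typing and of subtyping supply delays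
  \<open>k\<close> and \<open>n\<close> that make the types of parameter and argument meet.\<close>

lemma typing_beta_redex:
  assumes "typing G1 (lam x M) (Arr A B)" "typing G2 N A" "compat G1 G2" "lc M"
  shows "typing (G1 ++ G2) (msubst x N M) B"
proof (cases "spine_of B = STop")
  case True
  have "typing (G1 ++ G2) (App (lam x M) N) B"
    using assms(1-3) by (rule t_app)
  then have "wf_ctx (G1 ++ G2)" "tyexp B" "lc N"
    using typing_wf assms(2) by blast+
  then show ?thesis using True assms(4) by (simp add: typing_STop lc_msubst)
next
  case False
  have ty: "tyexp A" "tyexp B" using typing_wf[OF assms(1)] tyexp_ArrD by blast+
  have wf: "wf_ctx (G1 ++ G2)" and lcN: "lc N"
    using typing_wf[OF assms(1)] typing_wf[OF assms(2)] wf_ctx_map_add by auto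
  from False obtain k y M' A' B' where lam: "lam x M = lam y M'"
    and M': "typing (((later_ctx ^^ k) G1)(y \<mapsto> A')) M' B'"
    and sub: "subtype (Arr A' B') (lats k (Arr A B))"
    using typing_Abs_inversion[OF assms(1) lam_def] by auto
  have "subtype (Arr A' B') (Arr (lats k A) (lats k B))"
    using sub sub_distr_lats[OF ty] by (rule sub_trans')
  then obtain n where n: "subtype (lats k A) (lats n A')" "subtype (lats n B') (lats k B)"
    using sub_Arr_inversion[of A' B' "lats k A" "lats k B"] False by auto
  \<comment> \<open>The \<open>k\<close> delays demanded by the inversion are applied to the whole
    context; the shift rule removes them at the end.\<close>
  define G where "G = (later_ctx ^^ k) (G1 ++ G2)"
  have wfG: "wf_ctx G"
    unfolding G_def using wf by (induction k) (simp_all add: wf_later_ctx)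
  have N: "typing G N (lats n A')"
  proof (rule t_sub[OF _ n(1)])
    have "typing (G1 ++ G2) N A" using assms(2) wf by (rule typing_weaken) auto
    then show "typing G N (lats k A)" unfolding G_def by (rule typing_later_funpow)
  qed
  have "typing G (mpsubst (Var(y := N)) M') (lats n B')"
  \<comment> \<open>Delaying the body by \<open>n\<close> more steps turns its parameter type into
    \<open>\<bullet>\<^sup>n A'\<close>, the type just found for \<open>N\<close>.\<close>
  proof (rule typing_subst[OF typing_later_funpow[OF M'] wfG])
    show "\<forall>z. lc ((Var(y := N)) z)" using lcN by simp
    show "\<forall>z C. (later_ctx ^^ n) (((later_ctx ^^ k) G1)(y \<mapsto> A')) z = Some C \<longrightarrow>
        typing G ((Var(y := N)) z) C"
    proof (intro allI impI)
      fix z C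
      assume C: "(later_ctx ^^ n) (((later_ctx ^^ k) G1)(y \<mapsto> A')) z = Some C"
      show "typing G ((Var(y := N)) z) C"
      proof (cases "z = y")
        case True
        then show ?thesis using C N by (simp add: later_ctx_funpow)
      next
        case False
        then obtain D where D: "G1 z = Some D" "C = lats n (lats k D)"
          using C by (auto simp: later_ctx_funpow)
        then have G: "G z = Some (lats k D)"
          using map_add_compat[OF assms(3)] by (simp add: G_def later_ctx_funpow)
        \<comment> \<open>The delayed body expects \<open>n\<close> bullets more on the other
          variables than \<open>G\<close> provides; iterating \<open>X \<preceq> \<bullet>X\<close>
          makes up the difference.\<close>
        then have "subtype (lats k D) C"
          using D(2) wf_ctx_tyexp[OF wfG G] by (simp add: sub_lats_later wf_sa_def)
        then show ?thesis using t_sub[OF t_var[OF wfG G]] False by simp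
      qed
    qed
  qed
  then have "typing G (mpsubst (Var(y := N)) M') (lats k B)"
    using n(2) by (rule t_sub)
  moreover have "msubst x N M = mpsubst (Var(y := N)) M'"
    using lam_eq_msubst[OF lam assms(4)] typing_wf[OF M'] by (simp add: msubst_eq_mpsubst)
  ultimately show ?thesis
    using typing_shift_funpow unfolding G_def by simp
qed

theorem theorem7:
  assumes "typing G M A"
    and "beta M L"
  shows "typing G L A"
  using assms
proof (induction arbitrary: L rule: typing.induct)
  case (t_var G x A)
  from t_var.prems show ?case by cases (simp add: lam_def)
next
  case (t_shift G M A)
  show ?case using t_shift.IH[OF t_shift.prems] by (rule typing.t_shift)
next
  case (t_top G M)
  then show ?case using beta_lc typing.t_top by blast
next
  case (t_sub G M A B)
  show ?case using t_sub.IH[OF t_sub.prems] t_sub.hyps(2) by (rule typing.t_sub)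
next
  case (t_abs G x A M B)
  have "lc M" using typing_wf[OF t_abs.hyps(1)] by simp
  \<comment> \<open>Keeping the bound name \<open>x\<close> makes the context of the induction
    hypothesis fit.\<close>
  with t_abs.prems obtain M' where "L = lam x M'" "beta M M'" by (rule beta_lamE)
  then show ?case using typing.t_abs[OF t_abs.IH t_abs.hyps(2)] by blast
next
  case (t_app G1 M A B G2 N)
  from t_app.prems show ?case
  proof cases
    case (b_beta M' x)
    then show ?thesis using t_app.hyps typing_beta_redex by simp
  next
    case (b_app1 M')
    then show ?thesis using typing.t_app[OF t_app.IH(1) t_app.hyps(2,3)] by simp
  next
    case (b_app2 N')
    then show ?thesis using typing.t_app[OF t_app.hyps(1) t_app.IH(2) t_app.hyps(3)] by simp
  qed (simp add: lam_def)
qed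

end
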